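(* Let $\Omega\subseteq\mathbb{R}^n$ be open. For $\widetilde R\in\mathcal{G}^e(\Omega)$ the following are equivalent: (i) $\widetilde R$ is invertible in $\mathcal{G}^e(\Omega)$. (ii) For each representative $R$ of $\widetilde R$ the following holds: $$\forall K\subset\subset\Omega\ \exists m\in\mathbb{N}\ \exists q\in\mathbb{N}\ \forall\varphi\in\mathcal{A}_q(\mathbb{R}^n)\ \exists C>0\ \exists\varepsilon_0>0\ \forall\varepsilon<\varepsilon_0:\ \inf_{x\in K}|R(S_\varepsilon\varphi,x)|>C\varepsilon^m.$$ Moreover, in (ii) one can without loss of generality fix $C=1$, and one can always have $m=q$, without changing the condition.
   Context: Notation. $n\in\mathbb{N}=\{1,2,\dots\}$, $\mathbb{N}_0=\mathbb{N}\cup\{0\}$. $K\subset\subset\Omega$ means $K$ is a compact subset of $\Omega$. For expressions defined for small $\varepsilon>0$, $f(\varepsilon)=O(g(\varepsilon))$ means $\exists C>0\ \exists\varepsilon_0>0\ \forall\varepsilon<\varepsilon_0$: $|f(\varepsilon)|<C|g(\varepsilon)|$. $\mathcal{D}(\mathbb{R}^n)$ is the space of smooth compactly supported (complex-valued) functions. For $q\in\mathbb{N}_0$, $\mathcal{A}_q(\mathbb{R}^n)$ is the set of $\varphi\in\mathcal{D}(\mathbb{R}^n)$ with $\int\varphi=1$ and $\int x^\alpha\varphi(x)\,dx=0$ for all multi-indices $\alpha$ with $1\le|\alpha|\le q$. For $\varepsilon>0$, $(S_\varepsilon\varphi)(y):=\varepsilon^{-n}\varphi(y/\varepsilon)$.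 $U(\Omega):=\{(\varphi,x)\in\mathcal{A}_0(\mathbb{R}^n)\times\Omega: \operatorname{supp}\varphi+x\subseteq\Omega\}$. $\mathcal{E}^e(\Omega)$ is the set of functions $R:U(\Omega)\to\mathbb{C}$ that are smooth in the second variable $x$; $\partial^\alpha$ denotes derivatives with respect to $x$. $R$ is moderate ($R\in\mathcal{E}^e_M(\Omega)$) if $\forall K\subset\subset\Omega\ \forall\alpha\in\mathbb{N}_0^n\ \exists N\in\mathbb{N}\ \forall\varphi\in\mathcal{A}_N(\mathbb{R}^n)$: $\sup_{x\in K}|\partial^\alpha R(S_\varepsilon\varphi,x)|=O(\varepsilon^{-N})$. $R$ is negligible ($R\in\mathcal{N}^e(\Omega)$) if $\forall K\subset\subset\Omega\ \forall\alpha\in\mathbb{N}_0^n\ \forall m\in\mathbb{N}\ \exists q\in\mathbb{N}\ \forall\varphi\in\mathcal{A}_q(\mathbb{R}^n)$: $\sup_{x\in K}|\partial^\alpha R(S_\varepsilon\varphi,x)|=O(\varepsilon^{m})$. $\mathcal{G}^e(\Omega):=\mathcal{E}^e_M(\Omega)/\mathcal{N}^e(\Omega)$, a commutative ring with pointwise operations. *)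

theory Defs
  imports "HOL-Analysis.Analysis" "HOL-Algebra.QuotRing"
begin

section \<open>Smooth functions and partial derivatives\<close>

text \<open>
  All derivatives below are full derivatives \<^term>\<open>at x\<close>; the sets \<open>S\<close> are always open, so values
  outside \<open>S\<close> are irrelevant.
\<close>

primrec Ck_on ::
  "nat \<Rightarrow> ('a::real_normed_vector) set \<Rightarrow> ('a \<Rightarrow> 'b::real_normed_vector) \<Rightarrow> bool" where
  "Ck_on 0 S f \<longleftrightarrow> continuous_on S f"
| "Ck_on (Suc k) S f \<longleftrightarrow>
     (\<forall>x\<in>S. f differentiable (at x)) \<and> (\<forall>v. Ck_on k S (\<lambda>x. frechet_derivative f (at x) v))"

definition smooth_on ::
  "('a::real_normed_vector) set \<Rightarrow> ('a \<Rightarrow> 'b::real_normed_vector) \<Rightarrow> bool" where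
  "smooth_on S f \<longleftrightarrow> (\<forall>k. Ck_on k S f)"

definition partial_deriv :: "'n \<Rightarrow> (real^'n::finite \<Rightarrow> complex) \<Rightarrow> real^'n \<Rightarrow> complex" where
  "partial_deriv i f x = frechet_derivative f (at x) (axis i 1)"

text \<open>
  A multi-index is a function \<open>\<alpha> :: 'n \<Rightarrow> nat\<close>. The index type carries no order, so the partial
  derivatives are taken along an arbitrary list containing each \<open>i\<close> exactly \<open>\<alpha> i\<close> times; for
  smooth functions the order of differentiation does not matter.
\<close>

definition multi_deriv ::
  "('n \<Rightarrow> nat) \<Rightarrow> (real^'n::finite \<Rightarrow> complex) \<Rightarrow> real^'n \<Rightarrow> complex" where
  "multi_deriv \<alpha> f = foldr partial_deriv (SOME js. \<forall>i. count_list js i = \<alpha> i) f"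


section \<open>Test functions and mollifiers\<close>

definition supp :: "(real^'n::finite \<Rightarrow> complex) \<Rightarrow> (real^'n) set" where
  "supp \<phi> = closure {x. \<phi> x \<noteq> 0}"

definition test_functions :: "(real^'n::finite \<Rightarrow> complex) set" where
  "test_functions = {\<phi>. smooth_on UNIV \<phi> \<and> compact (supp \<phi>)}"

definition mollifiers :: "nat \<Rightarrow> (real^'n::finite \<Rightarrow> complex) set" where
  "mollifiers q = {\<phi> \<in> test_functions.
     (LINT x|lborel. \<phi> x) = 1 \<and>
     (\<forall>\<alpha>. 1 \<le> (\<Sum>i\<in>UNIV. \<alpha> i) \<and> (\<Sum>i\<in>UNIV. \<alpha> i) \<le> q \<longrightarrow>
        (LINT x|lborel. (\<Prod>i\<in>UNIV. x $ i ^ \<alpha> i) *\<^sub>R \<phi> x) = 0)}"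

definition scale :: "real \<Rightarrow> (real^'n::finite \<Rightarrow> complex) \<Rightarrow> real^'n \<Rightarrow> complex" where
  "scale \<epsilon> \<phi> y = inverse (\<epsilon> ^ CARD('n)) *\<^sub>R \<phi> (inverse \<epsilon> *\<^sub>R y)"

definition U_dom :: "(real^'n::finite) set \<Rightarrow> ((real^'n \<Rightarrow> complex) \<times> (real^'n)) set" where
  "U_dom \<Omega> = {(\<phi>, x). \<phi> \<in> mollifiers 0 \<and> x \<in> \<Omega> \<and> (\<lambda>y. y + x) ` supp \<phi> \<subseteq> \<Omega>}"


section \<open>The algebra of generalized functions\<close>

text \<open>
  Functions on \<^term>\<open>U_dom \<Omega>\<close> are total functions that are \<^const>\<open>undefined\<close> outside
  \<^term>\<open>U_dom \<Omega>\<close>, so that equality of representatives is equality of functions on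
  \<^term>\<open>U_dom \<Omega>\<close>.
\<close>

type_synonym 'n rep = "(real^'n \<Rightarrow> complex) \<times> (real^'n) \<Rightarrow> complex"

definition basic_space :: "(real^'n::finite) set \<Rightarrow> 'n rep set" where
  "basic_space \<Omega> = {R \<in> extensional (U_dom \<Omega>).
     \<forall>\<phi> \<in> mollifiers 0. smooth_on {x. (\<phi>, x) \<in> U_dom \<Omega>} (\<lambda>x. R (\<phi>, x))}"

text \<open>
  Suprema and infima of absolute values are taken in \<^typ>\<open>ennreal\<close>, so that the supremum over the
  empty set is 0 and the infimum over the empty set is infinite. For fixed \<open>\<phi>\<close> and compact
  \<open>K \<subseteq> \<Omega>\<close> the pairs \<open>(scale \<epsilon> \<phi>, x)\<close> with \<open>x \<in> K\<close> lie in \<^term>\<open>U_dom \<Omega>\<close> for all small \<open>\<epsilon> > 0\<close>;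
  as \<open>\<epsilon>\<^sub>0\<close> may always be decreased, other values of \<open>\<epsilon>\<close> play no role.
\<close>

definition big_O_0 :: "(real \<Rightarrow> ennreal) \<Rightarrow> (real \<Rightarrow> real) \<Rightarrow> bool" where
  "big_O_0 f g \<longleftrightarrow> (\<exists>C>0. \<exists>\<epsilon>\<^sub>0>0. \<forall>\<epsilon>. 0 < \<epsilon> \<and> \<epsilon> < \<epsilon>\<^sub>0 \<longrightarrow> f \<epsilon> < ennreal (C * \<bar>g \<epsilon>\<bar>))"

definition sup_deriv ::
  "'n rep \<Rightarrow> (real^'n::finite) set \<Rightarrow> ('n \<Rightarrow> nat) \<Rightarrow> (real^'n \<Rightarrow> complex) \<Rightarrow> real \<Rightarrow> ennreal" where
  "sup_deriv R K \<alpha> \<phi> \<epsilon> =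
     (SUP x\<in>K. ennreal (cmod (multi_deriv \<alpha> (\<lambda>y. R (scale \<epsilon> \<phi>, y)) x)))"

definition moderate :: "(real^'n::finite) set \<Rightarrow> 'n rep set" where
  "moderate \<Omega> = {R \<in> basic_space \<Omega>.
     \<forall>K \<alpha>. compact K \<and> K \<subseteq> \<Omega> \<longrightarrow>
       (\<exists>N\<ge>1. \<forall>\<phi>\<in>mollifiers N. big_O_0 (sup_deriv R K \<alpha> \<phi>) (\<lambda>\<epsilon>. \<epsilon> powi (- int N)))}"

definition negligible_reps :: "(real^'n::finite) set \<Rightarrow> 'n rep set" where
  "negligible_reps \<Omega> = {R \<in> basic_space \<Omega>.
     \<forall>K \<alpha>. \<forall>m::nat. compact K \<and> K \<subseteq> \<Omega> \<and> 1 \<le> m \<longrightarrow>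
       (\<exists>q\<ge>1. \<forall>\<phi>\<in>mollifiers q. big_O_0 (sup_deriv R K \<alpha> \<phi>) (\<lambda>\<epsilon>. \<epsilon> ^ m))}"

definition moderate_ring :: "(real^'n::finite) set \<Rightarrow> 'n rep ring" where
  "moderate_ring \<Omega> =
     \<lparr>carrier = moderate \<Omega>,
      mult = (\<lambda>R S. \<lambda>p\<in>U_dom \<Omega>. R p * S p),
      one = (\<lambda>p\<in>U_dom \<Omega>. 1),
      zero = (\<lambda>p\<in>U_dom \<Omega>. 0),
      add = (\<lambda>R S. \<lambda>p\<in>U_dom \<Omega>. R p + S p)\<rparr>"

text \<open>
  The elements of the quotient are cosets, so the representatives of a generalized function are
  precisely its elements.
\<close>

definition gen_fun_ring :: "(real^'n::finite) set \<Rightarrow> 'n rep set ring" where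
  "gen_fun_ring \<Omega> = moderate_ring \<Omega> Quot negligible_reps \<Omega>"

definition inf_exceeds ::
  "'n rep \<Rightarrow> (real^'n::finite) set \<Rightarrow> (real^'n \<Rightarrow> complex) \<Rightarrow> real \<Rightarrow> nat \<Rightarrow> real \<Rightarrow> bool" where
  "inf_exceeds R K \<phi> C m \<epsilon> \<longleftrightarrow>
     (INF x\<in>K. ennreal (cmod (R (scale \<epsilon> \<phi>, x)))) > ennreal (C * \<epsilon> ^ m)"

end

theory Submission
  imports Defs
begin

text \<open>
  Write \<open>S\<^sub>\<epsilon> \<phi>\<close> for \<open>scale \<epsilon> \<phi>\<close>. A class is invertible iff some \<open>S\<close> makes \<open>R S - 1\<close> negligible
  (\<open>Units_gen_fun_ring_iff\<close>), so the theorem compares the existence of such an \<open>S\<close> with the lower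
  bound \<open>\<bar>R(S\<^sub>\<epsilon> \<phi>, x)\<bar> \<ge> C \<epsilon>\<^sup>m\<close> on compact sets (\<open>bounded_below\<close>).

  If \<open>R S - 1\<close> is negligible, then \<open>\<bar>R\<bar> \<bar>S\<bar> \<ge> 1/2\<close> on a compact set for small \<open>\<epsilon>\<close>, whereas \<open>\<bar>S\<bar>\<close> is
  at most a constant times \<open>\<epsilon>\<^bsup>-N\<^esup>\<close>; dividing gives the lower bound
  (\<open>bounded_below_if_invertible\<close>).

  Conversely, \<open>1/R\<close> need not make sense: the lower bound controls \<open>R(S\<^sub>\<epsilon> \<phi>, x)\<close> only for small \<open>\<epsilon>\<close>,
  with a threshold depending on \<open>\<phi>\<close> and on the compact set, so \<open>R\<close> may well have zeros. Instead of
  cutting off, the denominator is perturbed: let \<open>\<delta>(\<phi>) = exp(-sup \<bar>\<phi>\<bar>)\<close>. This number is positive,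
  it does not depend on \<open>x\<close>, and it is negligible because \<open>sup \<bar>S\<^sub>\<epsilon> \<phi>\<bar>\<close> grows at least like
  \<open>1/\<epsilon>\<close>. Hence \<open>D = \<bar>R\<bar>\<^sup>2 + \<delta>\<close> vanishes nowhere, is moderate, and inherits a lower bound from \<open>R\<close>.
  Every derivative of \<open>1/D\<close> is a polynomial in \<open>1/D\<close> and the derivatives of \<open>D\<close>, so \<open>1/D\<close> is moderate.
  With \<open>S = cnj R / D\<close> one gets \<open>R S - 1 = - \<delta> / D\<close>, a product of a negligible and a moderate
  function (\<open>invertible_if_bounded_below\<close>).

  The four forms of the lower bound agree because both the exponent \<open>m\<close> and the moment order \<open>q\<close> may
  be increased: one additional factor \<open>\<epsilon>\<close> absorbs the constant \<open>C\<close>, and the larger of the two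
  numbers can then serve as both (\<open>inf_exceeds_if_bounded_below\<close>).

  These arguments rest on moderate functions forming a ring in which the negligible ones are an
  ideal, which is the Leibniz rule, applied by induction on the order of differentiation. For that
  induction \<open>moderate\<close> and \<open>negligible_reps\<close> are rephrased in terms of arbitrary iterated
  partial derivatives (\<open>moderate_iff\<close>, \<open>negligible_reps_iff\<close>). As \<^const>\<open>multi_deriv\<close> differentiates in
  an unspecified order, this step uses the symmetry of second derivatives (\<open>dirderiv_commute\<close>).
\<close>

section \<open>Calculus of smooth functions\<close>

abbreviation dirderiv :: "'a \<Rightarrow> ('a::real_normed_vector \<Rightarrow> 'b::real_normed_vector) \<Rightarrow> 'a \<Rightarrow> 'b" where
  "dirderiv v f x \<equiv> frechet_derivative f (at x) v"

lemma dirderiv_eqI: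
  assumes "(f has_derivative f') (at x)"
  shows "dirderiv v f x = f' v"
  using frechet_derivative_at[OF assms] by simp

text \<open>
  Differentiation is local, so on an open set the values elsewhere are irrelevant. This is what
  allows representatives to be altered outside \<^const>\<open>U_dom\<close>.
\<close>

lemma Ck_on_cong:
  assumes "open S" "\<And>x. x \<in> S \<Longrightarrow> f x = g x" "Ck_on k S f"
  shows "Ck_on k S g"
  using assms(2,3)
proof (induction k arbitrary: f g)
  case 0
  then show ?case using continuous_on_cong[of S S f g] by simp
next
  case (Suc k)
  have D: "(g has_derivative frechet_derivative f (at x)) (at x)" if x: "x \<in> S" for x
  proof (rule has_derivative_transform_within_open[OF _ assms(1) x])
    show "(f has_derivative frechet_derivative f (at x)) (at x)"
      using Suc.prems(2) x by (simp add: frechet_derivative_works)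
  qed (rule Suc.prems(1))
  have "Ck_on k S (dirderiv v g)" for v
  proof (rule Suc.IH)
    show "dirderiv v f x = dirderiv v g x" if "x \<in> S" for x
      using dirderiv_eqI[OF D[OF that]] by simp
    show "Ck_on k S (dirderiv v f)" using Suc.prems(2) by simp
  qed
  with D show ?case by (auto simp: differentiable_def)
qed

lemma Ck_on_Suc_imp: "Ck_on (Suc k) S f \<Longrightarrow> Ck_on k S f"
proof (induction k arbitrary: f)
  case 0
  then show ?case
    by (auto simp: continuous_on_eq_continuous_within
        dest!: bspec intro: differentiable_imp_continuous_within[OF differentiable_at_withinI])
next
  case (Suc k)
  note * = Suc.prems[unfolded Ck_on.simps(2)[of "Suc k"]]
  then have "Ck_on k S (dirderiv v f)" for v
    by (intro Suc.IH) blast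
  with * show ?case by simp
qed

lemma Ck_on_SucI:
  assumes "open S" and D: "\<And>x. x \<in> S \<Longrightarrow> (f has_derivative f' x) (at x)"
    and C: "\<And>v. Ck_on k S (\<lambda>x. f' x v)"
  shows "Ck_on (Suc k) S f"
proof -
  have "Ck_on k S (dirderiv v f)" for v
    using dirderiv_eqI[OF D] by (intro Ck_on_cong[OF assms(1) _ C[of v]]) simp
  then show ?thesis using D by (auto simp: differentiable_def)
qed

lemma Ck_on_SucD:
  assumes "Ck_on (Suc k) S f"
  shows "x \<in> S \<Longrightarrow> (f has_derivative frechet_derivative f (at x)) (at x)"
    "Ck_on k S (dirderiv v f)"
  using assms by (auto simp: frechet_derivative_works)

lemma Ck_on_const: "Ck_on k S (\<lambda>x. c)"
  by (induction k arbitrary: c) (auto simp: fun_eq_iff)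

lemma Ck_on_add:
  assumes "open S"
  shows "Ck_on k S f \<Longrightarrow> Ck_on k S g \<Longrightarrow> Ck_on k S (\<lambda>x. f x + g x)"
proof (induction k arbitrary: f g)
  case 0
  then show ?case by (auto intro: continuous_intros)
next
  case (Suc k)
  show ?case
    using Ck_on_SucD[OF Suc.prems(1)] Ck_on_SucD[OF Suc.prems(2)]
    by (intro Ck_on_SucI[OF assms, where f' = "\<lambda>x v. dirderiv v f x + dirderiv v g x"])
       (auto intro!: has_derivative_add Suc.IH)
qed

lemma (in bounded_linear) Ck_on:
  assumes "open S"
  shows "Ck_on k S g \<Longrightarrow> Ck_on k S (\<lambda>x. f (g x))"
proof (induction k arbitrary: g)
  case 0
  then show ?case by (auto intro: continuous_on)
next
  case (Suc k)
  show ?case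
    using Ck_on_SucD[OF Suc.prems]
    by (intro Ck_on_SucI[OF assms, where f' = "\<lambda>x v. f (dirderiv v g x)"])
       (auto intro!: has_derivative Suc.IH)
qed

text \<open>
  By the Leibniz rule the derivative is a sum of two products of functions that are k times
  continuously differentiable.
\<close>

lemma Ck_on_bilinear:
  assumes "bounded_bilinear pr" "open S"
  shows "Ck_on k S f \<Longrightarrow> Ck_on k S g \<Longrightarrow> Ck_on k S (\<lambda>x. pr (f x) (g x))"
proof (induction k arbitrary: f g)
  case 0
  then show ?case by (auto intro: bounded_bilinear.continuous_on[OF assms(1)])
next
  case (Suc k)
  show ?case
    using Ck_on_SucD[OF Suc.prems(1)] Ck_on_SucD[OF Suc.prems(2)]
    by (intro Ck_on_SucI[OF assms(2), where f' = "\<lambda>x v. pr (f x) (dirderiv v g x) + pr (dirderiv v f x) (g x)"])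
       (auto intro!: bounded_bilinear.FDERIV[OF assms(1)] Suc.IH Ck_on_add[OF assms(2)]
         Suc.prems[THEN Ck_on_Suc_imp] simp del: Ck_on.simps)
qed

text \<open>
  The derivative of \<open>1/f\<close> is a product of \<open>1/f\<close>, \<open>1/f\<close> and the derivative of \<open>f\<close>, to which the
  induction hypothesis and the product rule apply.
\<close>

lemma Ck_on_inverse:
  fixes f :: "'a::real_normed_vector \<Rightarrow> 'b::real_normed_field"
  assumes "open S" "\<And>x. x \<in> S \<Longrightarrow> f x \<noteq> 0"
  shows "Ck_on k S f \<Longrightarrow> Ck_on k S (\<lambda>x. inverse (f x))"
proof (induction k)
  case 0
  then show ?case using assms(2) by (auto intro: continuous_on_inverse)
next
  case (Suc k)
  have "(inverse \<circ> f has_derivative (\<lambda>v. - (inverse (f x) * dirderiv v f x * inverse (f x)))) (at x)"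
    if "x \<in> S" for x
    using that Ck_on_SucD[OF Suc.prems] assms(2)
    by (auto intro!: derivative_eq_intros)
  then show ?case
    using Ck_on_SucD[OF Suc.prems]
    by (intro Ck_on_SucI[OF assms(1), where
          f' = "\<lambda>x v. - (inverse (f x) * dirderiv v f x * inverse (f x))"])
       (auto intro!: Suc.IH Ck_on_bilinear[OF bounded_bilinear_mult assms(1)]
         bounded_linear.Ck_on[OF bounded_linear_minus[OF bounded_linear_ident] assms(1)]
         Suc.prems[THEN Ck_on_Suc_imp] simp: o_def simp del: Ck_on.simps)
qed

lemma Ck_on_comp_scaleR:
  "Ck_on k UNIV f \<Longrightarrow> Ck_on k UNIV (\<lambda>x. f (c *\<^sub>R x))"
proof (induction k arbitrary: f)
  case 0
  then show ?case by (auto intro!: continuous_intros continuous_on_compose2[of UNIV f])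
next
  case (Suc k)
  have "((\<lambda>x. f (c *\<^sub>R x)) has_derivative (\<lambda>v. dirderiv (c *\<^sub>R v) f (c *\<^sub>R x))) (at x)" for x
    using Ck_on_SucD(1)[OF Suc.prems, of "c *\<^sub>R x"]
    by (intro has_derivative_compose[of "\<lambda>x. c *\<^sub>R x" _ _ _ f, THEN has_derivative_eq_rhs])
       (auto intro!: derivative_eq_intros)
  then show ?case
    using Ck_on_SucD(2)[OF Suc.prems]
    by (intro Ck_on_SucI) (auto intro!: Suc.IH)
qed

lemma smooth_on_dirderiv: "smooth_on S f \<Longrightarrow> smooth_on S (dirderiv v f)"
  unfolding smooth_on_def using Ck_on_SucD(2) by blast

lemma smooth_on_has_derivative:
  "smooth_on S f \<Longrightarrow> x \<in> S \<Longrightarrow> (f has_derivative frechet_derivative f (at x)) (at x)"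
  unfolding smooth_on_def using Ck_on_SucD(1) by blast

lemma smooth_on_cong:
  "open S \<Longrightarrow> (\<And>x. x \<in> S \<Longrightarrow> f x = g x) \<Longrightarrow> smooth_on S f \<Longrightarrow> smooth_on S g"
  unfolding smooth_on_def by (blast intro: Ck_on_cong)

lemma dirderiv_cong:
  assumes "open S" "x \<in> S" "\<And>y. y \<in> S \<Longrightarrow> f y = g y" "f differentiable at x"
  shows "dirderiv v f x = dirderiv v g x"
  using frechet_derivative_transform_within_open[of f x S g] assms by simp



text \<open>
  The mean value theorem in direction \<open>u\<close> for \<open>s \<mapsto> f (x + s u + h v) - f (x + s u)\<close>, followed by the
  mean value theorem in direction \<open>v\<close>. The second difference on the left is symmetric in \<open>u\<close> and \<open>v\<close>,
  whereas the order of differentiation on the right is not.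
\<close>

lemma second_difference_mvt:
  fixes f :: "'a::real_normed_vector \<Rightarrow> real"
  assumes f: "smooth_on S f" and h: "0 < h"
    and S: "\<And>s t. 0 \<le> s \<Longrightarrow> s \<le> h \<Longrightarrow> 0 \<le> t \<Longrightarrow> t \<le> h \<Longrightarrow> x + s *\<^sub>R u + t *\<^sub>R v \<in> S"
  obtains s t where "0 < s" "s < h" "0 < t" "t < h"
    "f (x + h *\<^sub>R u + h *\<^sub>R v) - f (x + h *\<^sub>R u) - (f (x + h *\<^sub>R v) - f x)
      = h * h * dirderiv v (dirderiv u f) (x + s *\<^sub>R u + t *\<^sub>R v)"
proof -
  have line: "((\<lambda>s. g (y + s *\<^sub>R w)) has_real_derivative dirderiv w g (y + s *\<^sub>R w)) (at s)"
    if "smooth_on S g" "y + s *\<^sub>R w \<in> S" for g :: "'a \<Rightarrow> real" and y w s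
  proof -
    have "((\<lambda>s. y + s *\<^sub>R w) has_derivative (\<lambda>k. k *\<^sub>R w)) (at s)"
      by (auto intro!: derivative_eq_intros)
    from has_derivative_compose[OF this smooth_on_has_derivative[OF that]]
    have "((\<lambda>s. g (y + s *\<^sub>R w)) has_derivative (\<lambda>k. dirderiv (k *\<^sub>R w) g (y + s *\<^sub>R w))) (at s)" .
    moreover have "dirderiv (k *\<^sub>R w) g (y + s *\<^sub>R w) = dirderiv w g (y + s *\<^sub>R w) * k" for k
      using linear_cmul[OF has_derivative_linear[OF smooth_on_has_derivative[OF that]]] by simp
    ultimately show ?thesis
      by (simp add: has_field_derivative_def)
  qed
  have "\<exists>s>0. s < h \<and> (f (x + h *\<^sub>R v + h *\<^sub>R u) - f (x + h *\<^sub>R u)) - (f (x + h *\<^sub>R v + 0 *\<^sub>R u) - f (x + 0 *\<^sub>R u))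
      = (h - 0) * (dirderiv u f (x + h *\<^sub>R v + s *\<^sub>R u) - dirderiv u f (x + s *\<^sub>R u))"
    using h S[of _ h] S[of _ 0]
    by (intro MVT2[where f = "\<lambda>s. f (x + h *\<^sub>R v + s *\<^sub>R u) - f (x + s *\<^sub>R u)"] DERIV_diff line f)
       (auto simp: algebra_simps)
  then obtain s where s: "0 < s" "s < h" and
    eq1: "f (x + h *\<^sub>R u + h *\<^sub>R v) - f (x + h *\<^sub>R u) - (f (x + h *\<^sub>R v) - f x)
      = h * (dirderiv u f (x + s *\<^sub>R u + h *\<^sub>R v) - dirderiv u f (x + s *\<^sub>R u))"
    by (auto simp: add_ac)
  have "\<exists>t>0. t < h \<and> dirderiv u f (x + s *\<^sub>R u + h *\<^sub>R v) - dirderiv u f (x + s *\<^sub>R u + 0 *\<^sub>R v)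
      = (h - 0) * dirderiv v (dirderiv u f) (x + s *\<^sub>R u + t *\<^sub>R v)"
    using h s S[of s]
    by (intro MVT2[where f = "\<lambda>t. dirderiv u f (x + s *\<^sub>R u + t *\<^sub>R v)"] line smooth_on_dirderiv f) auto
  then obtain t where "0 < t" "t < h"
    "dirderiv u f (x + s *\<^sub>R u + h *\<^sub>R v) - dirderiv u f (x + s *\<^sub>R u)
      = h * dirderiv v (dirderiv u f) (x + s *\<^sub>R u + t *\<^sub>R v)" by auto
  with s eq1 that show ?thesis by simp
qed

text \<open>
  Both mixed derivatives, at suitable points close to \<open>x\<close>, equal the same second difference divided
  by \<open>h\<^sup>2\<close>. By continuity they agree at \<open>x\<close>.
\<close>

lemma dirderiv_commute_real:
  fixes f :: "'a::real_normed_vector \<Rightarrow> real"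
  assumes "open S" "smooth_on S f" "x \<in> S"
  shows "dirderiv v (dirderiv u f) x = dirderiv u (dirderiv v f) x"
proof -
  have *: "dist (dirderiv v (dirderiv u f) x) (dirderiv u (dirderiv v f) x) \<le> e + e" if "e > 0" for e
  proof -
    have cont: "\<exists>d>0. \<forall>y. dist y x < d \<longrightarrow> dist (dirderiv a (dirderiv b f) y) (dirderiv a (dirderiv b f) x) < e"
      for a b
    proof -
      have "continuous (at x) (dirderiv a (dirderiv b f))"
        using has_derivative_continuous[OF smooth_on_has_derivative] smooth_on_dirderiv assms by blast
      then show ?thesis using that
        unfolding continuous_at_eps_delta by blast
    qed
    obtain d1 where d1: "d1 > 0" "\<And>y. dist y x < d1 \<Longrightarrow> dist (dirderiv v (dirderiv u f) y) (dirderiv v (dirderiv u f) x) < e"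
      using cont by blast
    obtain d2 where d2: "d2 > 0" "\<And>y. dist y x < d2 \<Longrightarrow> dist (dirderiv u (dirderiv v f) y) (dirderiv u (dirderiv v f) x) < e"
      using cont by blast
    obtain d3 where d3: "d3 > 0" "\<And>y. dist y x < d3 \<Longrightarrow> y \<in> S"
      using assms(1,3) unfolding open_dist by blast
    define d where "d = min d1 (min d2 d3)"
    have d: "d > 0" using d1 d2 d3 by (simp add: d_def)
    \<comment> \<open>This keeps the parallelogram spanned by \<open>h u\<close> and \<open>h v\<close> within distance \<open>d\<close> of \<open>x\<close>.\<close>
    define h where "h = d / (norm u + norm v + 1)"
    have h: "h > 0" using d by (simp add: h_def add_nonneg_pos)
    have near: "dist (x + s *\<^sub>R a + t *\<^sub>R b) x < d"
      if "0 \<le> s" "s \<le> h" "0 \<le> t" "t \<le> h" and ab: "{a, b} = {u, v}" for s t a b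
    proof -
      have "norm a + norm b \<le> norm u + norm v" using ab by (auto simp: doubleton_eq_iff)
      have "dist (x + s *\<^sub>R a + t *\<^sub>R b) x = norm (s *\<^sub>R a + t *\<^sub>R b)"
        by (simp add: dist_norm add.assoc)
      also have "\<dots> \<le> s * norm a + t * norm b"
        using norm_triangle_ineq[of "s *\<^sub>R a" "t *\<^sub>R b"] that by simp
      also have "\<dots> \<le> h * norm a + h * norm b"
        using that by (intro add_mono mult_right_mono) auto
      also have "\<dots> \<le> h * (norm u + norm v)"
        using \<open>norm a + norm b \<le> _\<close> h by (simp add: ring_distribs(1)[symmetric])
      also have "\<dots> < h * (norm u + norm v + 1)" using h by (intro mult_strict_left_mono) auto
      also have "\<dots> = d"
        using add_nonneg_pos[of "norm u + norm v" 1] by (simp add: h_def)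
      finally show ?thesis .
    qed
    have S: "x + s *\<^sub>R a + t *\<^sub>R b \<in> S"
      if "0 \<le> s" "s \<le> h" "0 \<le> t" "t \<le> h" "{a, b} = {u, v}" for s t a b
      using near[OF that] d3 by (auto simp: d_def)
    obtain s t where st: "0 < s" "s < h" "0 < t" "t < h"
      "f (x + h *\<^sub>R u + h *\<^sub>R v) - f (x + h *\<^sub>R u) - (f (x + h *\<^sub>R v) - f x)
        = h * h * dirderiv v (dirderiv u f) (x + s *\<^sub>R u + t *\<^sub>R v)"
      by (rule second_difference_mvt[OF assms(2) h, of x u v]) (auto intro: S)
    obtain s' t' where st': "0 < s'" "s' < h" "0 < t'" "t' < h"
      "f (x + h *\<^sub>R v + h *\<^sub>R u) - f (x + h *\<^sub>R v) - (f (x + h *\<^sub>R u) - f x)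
        = h * h * dirderiv u (dirderiv v f) (x + s' *\<^sub>R v + t' *\<^sub>R u)"
      by (rule second_difference_mvt[OF assms(2) h, of x v u]) (auto intro: S)
    have "x + h *\<^sub>R v + h *\<^sub>R u = x + h *\<^sub>R u + h *\<^sub>R v" by (simp add: algebra_simps)
    then have "h * h * dirderiv v (dirderiv u f) (x + s *\<^sub>R u + t *\<^sub>R v)
        = h * h * dirderiv u (dirderiv v f) (x + s' *\<^sub>R v + t' *\<^sub>R u)"
      using st(5) st'(5) by (simp add: algebra_simps)
    then have eq: "dirderiv v (dirderiv u f) (x + s *\<^sub>R u + t *\<^sub>R v)
        = dirderiv u (dirderiv v f) (x + s' *\<^sub>R v + t' *\<^sub>R u)" using h by simp
    have "dist (dirderiv v (dirderiv u f) (x + s *\<^sub>R u + t *\<^sub>R v)) (dirderiv v (dirderiv u f) x) < e"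
      using near[of s t u v] st d1(2) by (simp add: d_def)
    moreover have "dist (dirderiv u (dirderiv v f) (x + s' *\<^sub>R v + t' *\<^sub>R u)) (dirderiv u (dirderiv v f) x) < e"
      using near[of s' t' v u] st' d2(2) by (simp add: d_def insert_commute)
    ultimately show ?thesis using eq by (simp add: dist_real_def)
  qed
  then have "dist (dirderiv v (dirderiv u f) x) (dirderiv u (dirderiv v f) x) \<le> 0 + e" if "e > 0" for e
    using *[of "e/2"] that by simp
  then have "dist (dirderiv v (dirderiv u f) x) (dirderiv u (dirderiv v f) x) \<le> 0"
    using field_le_epsilon by blast
  then show ?thesis by simp
qed

lemma (in bounded_linear) dirderiv_comp:
  assumes "smooth_on S g" "x \<in> S"
  shows "dirderiv v (\<lambda>x. f (g x)) x = f (dirderiv v g x)"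
  by (rule dirderiv_eqI) (rule has_derivative smooth_on_has_derivative assms)+

lemma (in bounded_linear) smooth_on: "open S \<Longrightarrow> smooth_on S g \<Longrightarrow> smooth_on S (\<lambda>x. f (g x))"
  by (simp add: smooth_on_def Ck_on)

lemma (in bounded_linear) dirderiv_dirderiv_comp:
  assumes "open S" "smooth_on S g" "x \<in> S"
  shows "dirderiv u (dirderiv v (\<lambda>x. f (g x))) x = f (dirderiv u (dirderiv v g) x)"
proof -
  have "dirderiv u (dirderiv v (\<lambda>x. f (g x))) x = dirderiv u (\<lambda>x. f (dirderiv v g x)) x"
  proof (rule dirderiv_cong[OF assms(1,3)])
    show "dirderiv v (\<lambda>x. f (g x)) y = f (dirderiv v g y)" if "y \<in> S" for y
      using dirderiv_comp[OF assms(2) that] .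
    have "smooth_on S (dirderiv v (\<lambda>x. f (g x)))"
      by (intro smooth_on_dirderiv smooth_on assms)
    from smooth_on_has_derivative[OF this assms(3)]
    show "dirderiv v (\<lambda>x. f (g x)) differentiable at x"
      by (rule differentiableI)
  qed
  also have "\<dots> = f (dirderiv u (dirderiv v g) x)"
    by (rule dirderiv_comp[OF smooth_on_dirderiv[OF assms(2)] assms(3)])
  finally show ?thesis .
qed

text \<open>
  The mean value theorem applies to the real and the imaginary part separately.
\<close>

lemma dirderiv_commute:
  fixes f :: "'a::real_normed_vector \<Rightarrow> complex"
  assumes "open S" "smooth_on S f" "x \<in> S"
  shows "dirderiv v (dirderiv u f) x = dirderiv u (dirderiv v f) x"
proof (rule complex_eqI)
  note comp = bounded_linear.dirderiv_dirderiv_comp[OF _ assms, symmetric]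
  show "Re (dirderiv v (dirderiv u f) x) = Re (dirderiv u (dirderiv v f) x)"
    unfolding comp[OF bounded_linear_Re]
    by (rule dirderiv_commute_real[OF assms(1) bounded_linear.smooth_on[OF bounded_linear_Re assms(1,2)] assms(3)])
  show "Im (dirderiv v (dirderiv u f) x) = Im (dirderiv u (dirderiv v f) x)"
    unfolding comp[OF bounded_linear_Im]
    by (rule dirderiv_commute_real[OF assms(1) bounded_linear.smooth_on[OF bounded_linear_Im assms(1,2)] assms(3)])
qed

section \<open>Mollifiers and their scalings\<close>

lemma mollifiers_mono: "p \<le> q \<Longrightarrow> mollifiers q \<subseteq> mollifiers p"
  unfolding mollifiers_def by fastforce

lemma mollifiers_0: "mollifiers 0 = {\<phi> \<in> test_functions. (LINT x|lborel. \<phi> x) = 1}"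
proof -
  have "\<not> (1 \<le> s \<and> s \<le> 0)" for s :: nat by simp
  then show ?thesis unfolding mollifiers_def by blast
qed

lemma compact_supp_mollifier: "\<phi> \<in> mollifiers q \<Longrightarrow> compact (supp \<phi>)"
  by (simp add: mollifiers_def test_functions_def)

lemma supp_scale:
  assumes "0 < \<epsilon>"
  shows "supp (scale \<epsilon> \<phi>) = (\<lambda>y. \<epsilon> *\<^sub>R y) ` supp \<phi>"
proof -
  have "{x. scale \<epsilon> \<phi> x \<noteq> 0} = (\<lambda>y. \<epsilon> *\<^sub>R y) ` {x. \<phi> x \<noteq> 0}"
  proof -
    have "x \<in> (\<lambda>y. \<epsilon> *\<^sub>R y) ` {x. \<phi> x \<noteq> 0}" if "scale \<epsilon> \<phi> x \<noteq> 0" for x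
      using assms that by (intro image_eqI[where x = "inverse \<epsilon> *\<^sub>R x"]) (auto simp: scale_def)
    then show ?thesis using assms by (auto simp: scale_def)
  qed
  then show ?thesis by (simp add: supp_def closure_scaleR)
qed

lemma integral_scale:
  fixes \<phi> :: "real^'n::finite \<Rightarrow> complex"
  assumes "0 < \<epsilon>" "\<phi> \<in> borel_measurable borel"
  shows "(LINT x|lborel. scale \<epsilon> \<phi> x) = (LINT x|lborel. \<phi> x)"
proof -
  have "(LINT x|lborel. \<phi> x)
      = (LINT x|density (distr lborel borel (\<lambda>x. 0 + inverse \<epsilon> *\<^sub>R x)) (\<lambda>_. \<bar>inverse \<epsilon>\<bar>^DIM(real^'n)). \<phi> x)"
    using assms by (subst lborel_affine[of "inverse \<epsilon>" 0]) auto
  also have "\<dots> = (LINT x|distr lborel borel (\<lambda>x. 0 + inverse \<epsilon> *\<^sub>R x). (inverse \<epsilon> ^ CARD('n)) *\<^sub>R \<phi> x)"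
    using assms by (subst integral_density) auto
  also have "\<dots> = (LINT x|lborel. scale \<epsilon> \<phi> x)"
    using assms by (subst integral_distr) (auto simp: scale_def[abs_def] power_inverse)
  finally show ?thesis by simp
qed

lemma scale_in_mollifiers:
  assumes "0 < \<epsilon>" "\<phi> \<in> mollifiers 0"
  shows "scale \<epsilon> \<phi> \<in> mollifiers 0"
proof -
  have \<phi>: "smooth_on UNIV \<phi>" "compact (supp \<phi>)" "(LINT x|lborel. \<phi> x) = 1"
    using assms(2) by (auto simp: mollifiers_def test_functions_def)
  have "continuous_on UNIV \<phi>"
    using \<phi>(1) Ck_on.simps(1) unfolding smooth_on_def by blast
  then have int: "(LINT x|lborel. scale \<epsilon> \<phi> x) = 1"
    by (rule trans[OF integral_scale[OF assms(1) borel_measurable_continuous_onI] \<phi>(3)])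
  have "Ck_on k UNIV (scale \<epsilon> \<phi>)" for k
    unfolding scale_def[abs_def] using \<phi>(1)[unfolded smooth_on_def]
    by (intro bounded_linear.Ck_on[OF bounded_linear_scaleR_right open_UNIV Ck_on_comp_scaleR]) blast
  then have "smooth_on UNIV (scale \<epsilon> \<phi>)" by (simp add: smooth_on_def)
  moreover have "compact (supp (scale \<epsilon> \<phi>))"
    using \<phi>(2) by (simp add: supp_scale[OF assms(1)] compact_scaling)
  ultimately show ?thesis
    using int by (simp add: mollifiers_0 test_functions_def)
qed

text \<open>
  The support of \<open>S\<^sub>\<epsilon> \<phi>\<close> is contained in a ball of radius proportional to \<open>\<epsilon>\<close>, and some
  neighbourhood of \<open>K\<close> of positive radius lies in \<open>\<Omega>\<close>.
\<close>

lemma eventually_scale_in_U_dom: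
  assumes "open \<Omega>" "compact K" "K \<subseteq> \<Omega>" "\<phi> \<in> mollifiers 0"
  shows "\<forall>\<^sub>F \<epsilon> in at_right 0. \<forall>x\<in>K. (scale \<epsilon> \<phi>, x) \<in> U_dom \<Omega>"
proof -
  obtain d where d: "d > 0" "(\<Union>x\<in>K. ball x d) \<subseteq> \<Omega>"
    using compact_subset_open_imp_ball_epsilon_subset[OF assms(2,1,3)] by blast
  obtain r where r: "r > 0" "\<And>y. y \<in> supp \<phi> \<Longrightarrow> norm y \<le> r"
    using compact_imp_bounded[OF compact_supp_mollifier[OF assms(4)]] bounded_pos by metis
  have "(scale \<epsilon> \<phi>, x) \<in> U_dom \<Omega>" if "0 < \<epsilon>" "\<epsilon> < d / r" "x \<in> K" for \<epsilon> x
  proof -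
    have "\<epsilon> *\<^sub>R y + x \<in> \<Omega>" if "y \<in> supp \<phi>" for y
    proof -
      have "norm (\<epsilon> *\<^sub>R y) \<le> \<epsilon> * r" using r that \<open>0 < \<epsilon>\<close> by simp
      also have "\<dots> < d" using \<open>\<epsilon> < d / r\<close> r by (simp add: field_simps)
      finally have "\<epsilon> *\<^sub>R y + x \<in> ball x d" by (simp add: dist_norm)
      then show ?thesis using d \<open>x \<in> K\<close> by blast
    qed
    then show ?thesis
      using that assms scale_in_mollifiers by (auto simp: U_dom_def supp_scale)
  qed
  moreover have "\<forall>\<^sub>F \<epsilon> in at_right 0. 0 < \<epsilon> \<and> \<epsilon> < d / r"
    using d r by (intro eventually_at_rightI[of 0 "d / r"]) auto
  then show ?thesis by (rule eventually_mono) (use calculation in blast)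
qed

text \<open>
  For a mollifier, a point \<open>x\<close> belongs to the slice iff the compact set consisting of \<open>x\<close> and the translated
  support lies in \<open>\<Omega>\<close>; then so does a neighbourhood of this set.
\<close>

lemma open_U_dom_slice:
  assumes "open \<Omega>"
  shows "open {x. (\<phi>, x) \<in> U_dom \<Omega>}"
proof (cases "\<phi> \<in> mollifiers 0")
  case False
  then show ?thesis by (simp add: U_dom_def)
next
  case True
  show ?thesis unfolding open_dist
  proof safe
    fix x assume x: "(\<phi>, x) \<in> U_dom \<Omega>"
    let ?K = "insert x ((\<lambda>y. x + y) ` supp \<phi>)"
    have "compact ?K"
      using compact_translation[OF compact_supp_mollifier[OF True], of x] by (rule compact_insert)
    moreover have "?K \<subseteq> \<Omega>"
      using x by (auto simp: U_dom_def add.commute)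
    ultimately obtain e where e: "e > 0" "(\<Union>z\<in>?K. ball z e) \<subseteq> \<Omega>"
      using compact_subset_open_imp_ball_epsilon_subset assms by metis
    have "(\<phi>, x') \<in> U_dom \<Omega>" if x': "dist x' x < e" for x'
    proof -
      have "x' \<in> ball x e" "\<And>y. y + x' \<in> ball (x + y) e"
        using x' by (simp_all add: dist_norm norm_minus_commute algebra_simps)
      then have "x' \<in> \<Omega>" "\<And>y. y \<in> supp \<phi> \<Longrightarrow> y + x' \<in> \<Omega>"
        using e(2) by blast+
      then show ?thesis using True by (auto simp: U_dom_def)
    qed
    with e show "\<exists>e>0. \<forall>x'. dist x' x < e \<longrightarrow> x' \<in> {x. (\<phi>, x) \<in> U_dom \<Omega>}" by auto
  qed
qed

section \<open>Differentiating representatives\<close>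

text \<open>
  The partial derivative in \<open>x\<close> as an operation on representatives. Its values are again extensional, so
  that the rules of differentiation are equations between representatives and can be iterated.
\<close>

definition rep_partial :: "(real^'n::finite) set \<Rightarrow> 'n \<Rightarrow> 'n rep \<Rightarrow> 'n rep" where
  "rep_partial \<Omega> i R = (\<lambda>p\<in>U_dom \<Omega>. partial_deriv i (\<lambda>y. R (fst p, y)) (snd p))"

lemma basic_space_restrictI:
  assumes "open \<Omega>" "\<And>\<phi>. \<phi> \<in> mollifiers 0 \<Longrightarrow> smooth_on {x. (\<phi>, x) \<in> U_dom \<Omega>} (\<lambda>x. f (\<phi>, x))"
  shows "(\<lambda>p\<in>U_dom \<Omega>. f p) \<in> basic_space \<Omega>"
  using smooth_on_cong[OF open_U_dom_slice[OF assms(1)] _ assms(2)]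
  by (auto simp: basic_space_def)

lemma basic_space_smooth:
  assumes "R \<in> basic_space \<Omega>"
  shows "smooth_on {x. (\<phi>, x) \<in> U_dom \<Omega>} (\<lambda>x. R (\<phi>, x))"
proof (cases "\<phi> \<in> mollifiers 0")
  case True
  then show ?thesis using assms by (simp add: basic_space_def)
next
  case False
  then have "{x. (\<phi>, x) \<in> U_dom \<Omega>} = {}" by (simp add: U_dom_def)
  moreover have "Ck_on k {} f" for k and f :: "(real^'a) \<Rightarrow> complex"
    by (induction k arbitrary: f) auto
  ultimately show ?thesis by (simp add: smooth_on_def)
qed

lemma basic_space_Ck_on:
  "R \<in> basic_space \<Omega> \<Longrightarrow> Ck_on k {x. (\<phi>, x) \<in> U_dom \<Omega>} (\<lambda>x. R (\<phi>, x))"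
  using basic_space_smooth unfolding smooth_on_def by blast

lemma basic_space_has_derivative:
  assumes "R \<in> basic_space \<Omega>" "(\<phi>, x) \<in> U_dom \<Omega>"
  shows "((\<lambda>y. R (\<phi>, y)) has_derivative frechet_derivative (\<lambda>y. R (\<phi>, y)) (at x)) (at x)"
  using smooth_on_has_derivative[OF basic_space_smooth[OF assms(1)]] assms(2) by simp

lemma rep_partial_basic_space: "open \<Omega> \<Longrightarrow> R \<in> basic_space \<Omega> \<Longrightarrow> rep_partial \<Omega> i R \<in> basic_space \<Omega>"
  unfolding rep_partial_def partial_deriv_def
  by (rule basic_space_restrictI) (simp_all add: smooth_on_dirderiv[OF basic_space_smooth])

lemma foldr_rep_partial_basic_space:
  "open \<Omega> \<Longrightarrow> R \<in> basic_space \<Omega> \<Longrightarrow> foldr (rep_partial \<Omega>) js R \<in> basic_space \<Omega>"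
  by (induction js) (auto intro: rep_partial_basic_space)

lemma rep_partial_apply: "(\<phi>, x) \<in> U_dom \<Omega> \<Longrightarrow> rep_partial \<Omega> i R (\<phi>, x) = dirderiv (axis i 1) (\<lambda>y. R (\<phi>, y)) x"
  by (simp add: rep_partial_def partial_deriv_def)

lemma dirderiv_slice_cong:
  assumes "open \<Omega>" "(\<phi>, x) \<in> U_dom \<Omega>" "\<And>y. (\<phi>, y) \<in> U_dom \<Omega> \<Longrightarrow> f y = g y"
    "(g has_derivative g') (at x)"
  shows "dirderiv v f x = g' v"
  by (rule dirderiv_eqI, rule has_derivative_transform_within_open[OF assms(4)
        open_U_dom_slice[OF assms(1)]]) (use assms in auto)

lemma rep_partial_restrict:
  assumes "open \<Omega>" "\<And>\<phi> x. (\<phi>, x) \<in> U_dom \<Omega> \<Longrightarrow>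
     \<exists>f'. ((\<lambda>y. f (\<phi>, y)) has_derivative f') (at x) \<and> f' (axis i 1) = g (\<phi>, x)"
  shows "rep_partial \<Omega> i (\<lambda>p\<in>U_dom \<Omega>. f p) = (\<lambda>p\<in>U_dom \<Omega>. g p)"
proof (rule ext, clarify)
  fix \<phi> x
  show "rep_partial \<Omega> i (\<lambda>p\<in>U_dom \<Omega>. f p) (\<phi>, x) = (\<lambda>p\<in>U_dom \<Omega>. g p) (\<phi>, x)"
  proof (cases "(\<phi>, x) \<in> U_dom \<Omega>")
    case True
    obtain f' where f': "((\<lambda>y. f (\<phi>, y)) has_derivative f') (at x)" "f' (axis i 1) = g (\<phi>, x)"
      using assms(2)[OF True] by blast
    show ?thesis
      using dirderiv_slice_cong[OF assms(1) True _ f'(1), of "\<lambda>y. (\<lambda>p\<in>U_dom \<Omega>. f p) (\<phi>, y)"]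
        True f'(2) by (simp add: rep_partial_apply)
  qed (simp add: rep_partial_def)
qed

lemma rep_partial_commute:
  assumes "open \<Omega>" "R \<in> basic_space \<Omega>"
  shows "rep_partial \<Omega> i (rep_partial \<Omega> j R) = rep_partial \<Omega> j (rep_partial \<Omega> i R)"
proof (rule ext, clarify)
  fix \<phi> x
  show "rep_partial \<Omega> i (rep_partial \<Omega> j R) (\<phi>, x) = rep_partial \<Omega> j (rep_partial \<Omega> i R) (\<phi>, x)"
  proof (cases "(\<phi>, x) \<in> U_dom \<Omega>")
    case True
    have "rep_partial \<Omega> i (rep_partial \<Omega> j R) (\<phi>, x) = dirderiv (axis i 1) (dirderiv (axis j 1) (\<lambda>y. R (\<phi>, y))) x" for i j
      unfolding rep_partial_apply[OF True, of i]
      by (rule dirderiv_slice_cong[OF assms(1) True])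
         (auto simp: rep_partial_apply True
           intro!: smooth_on_has_derivative smooth_on_dirderiv basic_space_smooth[OF assms(2)])
    then show ?thesis
      using dirderiv_commute[OF open_U_dom_slice[OF assms(1)] basic_space_smooth[OF assms(2)], of x \<phi>] True
      by simp
  qed (simp add: rep_partial_def)
qed

lemma foldr_rep_partial_apply:
  assumes "open \<Omega>" "R \<in> basic_space \<Omega>"
  shows "(\<phi>, x) \<in> U_dom \<Omega> \<Longrightarrow> foldr partial_deriv js (\<lambda>y. R (\<phi>, y)) x = foldr (rep_partial \<Omega>) js R (\<phi>, x)"
proof (induction js arbitrary: x)
  case (Cons j js)
  have "dirderiv (axis j 1) (foldr partial_deriv js (\<lambda>y. R (\<phi>, y))) x
      = dirderiv (axis j 1) (\<lambda>y. foldr (rep_partial \<Omega>) js R (\<phi>, y)) x"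
    by (rule dirderiv_slice_cong[OF assms(1) Cons.prems Cons.IH])
       (auto intro: basic_space_has_derivative foldr_rep_partial_basic_space assms Cons.prems)
  then show ?case
    using Cons.prems by (simp add: rep_partial_apply partial_deriv_def[of j])
qed simp

text \<open>
  Since partial derivatives commute on smooth representatives, an iterated derivative depends only on
  how often each direction occurs. This makes the choice of the list in \<^const>\<open>multi_deriv\<close> immaterial.
\<close>

lemma foldr_rep_partial_permute:
  assumes "open \<Omega>" "R \<in> basic_space \<Omega>" "\<And>i. count_list js i = count_list js' i"
  shows "foldr (rep_partial \<Omega>) js R = foldr (rep_partial \<Omega>) js' R"
proof -
  have "mset (rev js) = mset (rev js')"
    using assms(3) by (simp add: multiset_eq_iff count_mset)
  then show ?thesis unfolding foldr_conv_fold
    by (rule fold_permuted_eq[where P = "\<lambda>R. R \<in> basic_space \<Omega>"])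
       (auto intro: assms rep_partial_basic_space rep_partial_commute)
qed

definition index_list :: "('n::finite \<Rightarrow> nat) \<Rightarrow> 'n list" where
  "index_list \<alpha> = (SOME js. \<forall>i. count_list js i = \<alpha> i)"

lemma count_index_list: "count_list (index_list (\<alpha> :: 'n::finite \<Rightarrow> nat)) i = \<alpha> i"
proof -
  obtain js where "mset js = Abs_multiset \<alpha>" using ex_mset by blast
  then have "\<forall>i. count_list js i = \<alpha> i"
    by (metis count_mset count_Abs_multiset finite)
  then show ?thesis
    unfolding index_list_def by (rule someI[THEN spec])
qed

lemma multi_deriv_apply:
  assumes "open \<Omega>" "R \<in> basic_space \<Omega>" "(\<phi>, x) \<in> U_dom \<Omega>"
  shows "multi_deriv \<alpha> (\<lambda>y. R (\<phi>, y)) x = foldr (rep_partial \<Omega>) (index_list \<alpha>) R (\<phi>, x)"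
  unfolding multi_deriv_def index_list_def[symmetric] by (rule foldr_rep_partial_apply[OF assms])

lemma foldr_rep_partial_index_list:
  "open \<Omega> \<Longrightarrow> R \<in> basic_space \<Omega> \<Longrightarrow> foldr (rep_partial \<Omega>) js R = foldr (rep_partial \<Omega>) (index_list (count_list js)) R"
  by (rule foldr_rep_partial_permute) (auto simp: count_index_list)

lemma basic_space_fst: "open \<Omega> \<Longrightarrow> (\<lambda>p\<in>U_dom \<Omega>. c (fst p)) \<in> basic_space \<Omega>"
  by (rule basic_space_restrictI) (auto simp: smooth_on_def Ck_on_const)

lemma basic_space_add:
  "open \<Omega> \<Longrightarrow> R \<in> basic_space \<Omega> \<Longrightarrow> S \<in> basic_space \<Omega> \<Longrightarrow> (\<lambda>p\<in>U_dom \<Omega>. R p + S p) \<in> basic_space \<Omega>"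
  by (rule basic_space_restrictI)
     (simp_all add: smooth_on_def Ck_on_add open_U_dom_slice basic_space_Ck_on)

lemma basic_space_mult:
  "open \<Omega> \<Longrightarrow> R \<in> basic_space \<Omega> \<Longrightarrow> S \<in> basic_space \<Omega> \<Longrightarrow> (\<lambda>p\<in>U_dom \<Omega>. R p * S p) \<in> basic_space \<Omega>"
  by (rule basic_space_restrictI)
     (simp_all add: smooth_on_def Ck_on_bilinear[OF bounded_bilinear_mult] open_U_dom_slice
       basic_space_Ck_on)

lemma basic_space_cnj:
  "open \<Omega> \<Longrightarrow> R \<in> basic_space \<Omega> \<Longrightarrow> (\<lambda>p\<in>U_dom \<Omega>. cnj (R p)) \<in> basic_space \<Omega>"
  by (intro basic_space_restrictI bounded_linear.smooth_on[OF bounded_linear_cnj] open_U_dom_slice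
      basic_space_smooth)

lemma basic_space_inverse:
  "open \<Omega> \<Longrightarrow> R \<in> basic_space \<Omega> \<Longrightarrow> (\<And>p. p \<in> U_dom \<Omega> \<Longrightarrow> R p \<noteq> 0)
    \<Longrightarrow> (\<lambda>p\<in>U_dom \<Omega>. inverse (R p)) \<in> basic_space \<Omega>"
  by (rule basic_space_restrictI)
     (auto simp: smooth_on_def intro!: Ck_on_inverse open_U_dom_slice intro: basic_space_Ck_on)

lemma rep_partial_fst:
  assumes "open \<Omega>"
  shows "rep_partial \<Omega> i (\<lambda>p\<in>U_dom \<Omega>. c (fst p)) = (\<lambda>p\<in>U_dom \<Omega>. 0)"
  by (rule rep_partial_restrict[OF assms]) (auto intro!: exI has_derivative_const)

lemma rep_partial_add:
  assumes "open \<Omega>" "R \<in> basic_space \<Omega>" "S \<in> basic_space \<Omega>"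
  shows "rep_partial \<Omega> i (\<lambda>p\<in>U_dom \<Omega>. R p + S p) = (\<lambda>p\<in>U_dom \<Omega>. rep_partial \<Omega> i R p + rep_partial \<Omega> i S p)"
  using basic_space_has_derivative[OF assms(2)] basic_space_has_derivative[OF assms(3)]
  by (intro rep_partial_restrict[OF assms(1)])
     (auto intro!: exI conjI has_derivative_add simp: rep_partial_apply)

lemma rep_partial_mult:
  assumes "open \<Omega>" "R \<in> basic_space \<Omega>" "S \<in> basic_space \<Omega>"
  shows "rep_partial \<Omega> i (\<lambda>p\<in>U_dom \<Omega>. R p * S p) =
    (\<lambda>p\<in>U_dom \<Omega>. (\<lambda>p\<in>U_dom \<Omega>. R p * rep_partial \<Omega> i S p) p + (\<lambda>p\<in>U_dom \<Omega>. rep_partial \<Omega> i R p * S p) p)"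
  using basic_space_has_derivative[OF assms(2)] basic_space_has_derivative[OF assms(3)]
  by (intro rep_partial_restrict[OF assms(1)])
     (auto intro!: exI conjI has_derivative_mult simp: rep_partial_apply)

lemma rep_partial_cnj:
  assumes "open \<Omega>" "R \<in> basic_space \<Omega>"
  shows "rep_partial \<Omega> i (\<lambda>p\<in>U_dom \<Omega>. cnj (R p)) = (\<lambda>p\<in>U_dom \<Omega>. cnj (rep_partial \<Omega> i R p))"
  using basic_space_has_derivative[OF assms(2)]
  by (intro rep_partial_restrict[OF assms(1)])
     (auto intro!: exI conjI bounded_linear.has_derivative[OF bounded_linear_cnj] simp: rep_partial_apply)

lemma rep_partial_inverse:
  assumes "open \<Omega>" "R \<in> basic_space \<Omega>" "\<And>p. p \<in> U_dom \<Omega> \<Longrightarrow> R p \<noteq> 0"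
  shows "rep_partial \<Omega> i (\<lambda>p\<in>U_dom \<Omega>. inverse (R p)) =
    (\<lambda>p\<in>U_dom \<Omega>. (\<lambda>p\<in>U_dom \<Omega>. (\<lambda>p\<in>U_dom \<Omega>. - 1) p * rep_partial \<Omega> i R p) p *
       (\<lambda>p\<in>U_dom \<Omega>. (\<lambda>p\<in>U_dom \<Omega>. inverse (R p)) p * (\<lambda>p\<in>U_dom \<Omega>. inverse (R p)) p) p)"
proof (rule rep_partial_restrict[OF assms(1)], intro exI conjI)
  fix \<phi> x assume p: "(\<phi>, x) \<in> U_dom \<Omega>"
  show "((\<lambda>y. inverse (R (\<phi>, y))) has_derivative
    (\<lambda>v. - (inverse (R (\<phi>, x)) * dirderiv v (\<lambda>y. R (\<phi>, y)) x * inverse (R (\<phi>, x))))) (at x)"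
    using assms(3)[OF p] basic_space_has_derivative[OF assms(2) p] by (rule Deriv.has_derivative_inverse)
qed (simp add: rep_partial_apply)

text \<open>
  All iterated partial derivatives of order at most \<open>k\<close> have the property \<open>P\<close>. The recursion takes off the
  derivative that is applied first, which is the form in which the rules for \<^const>\<open>rep_partial\<close> feed an
  induction on \<open>k\<close>.
\<close>

primrec jets :: "(real^'n::finite) set \<Rightarrow> ('n rep \<Rightarrow> bool) \<Rightarrow> nat \<Rightarrow> 'n rep \<Rightarrow> bool" where
  "jets \<Omega> P 0 R \<longleftrightarrow> P R"
| "jets \<Omega> P (Suc k) R \<longleftrightarrow> P R \<and> (\<forall>i. jets \<Omega> P k (rep_partial \<Omega> i R))"

lemma jets_imp: "jets \<Omega> P k R \<Longrightarrow> P R"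
  by (cases k) auto

lemma jets_Suc_imp: "jets \<Omega> P (Suc k) R \<Longrightarrow> jets \<Omega> P k R"
  by (induction k arbitrary: R) auto

lemma jets_mono: "(\<And>R. P R \<Longrightarrow> Q R) \<Longrightarrow> jets \<Omega> P k R \<Longrightarrow> jets \<Omega> Q k R"
  by (induction k arbitrary: R) auto

lemma jets_iff_foldr: "jets \<Omega> P k R \<longleftrightarrow> (\<forall>js. length js \<le> k \<longrightarrow> P (foldr (rep_partial \<Omega>) js R))"
proof (induction k arbitrary: R)
  case (Suc k)
  have "(\<forall>js. length js \<le> Suc k \<longrightarrow> P (foldr (rep_partial \<Omega>) js R)) \<longleftrightarrow>
      P R \<and> (\<forall>i js. length js \<le> k \<longrightarrow> P (foldr (rep_partial \<Omega>) (js @ [i]) R))" (is "?L \<longleftrightarrow> ?R")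
  proof
    assume ?L
    from this[THEN spec, of "[]"] this[THEN spec, of "_ @ [_]"] show ?R by simp
  next
    assume R: ?R
    show ?L
    proof (intro allI impI)
      fix js :: "'a list" assume "length js \<le> Suc k"
      then show "P (foldr (rep_partial \<Omega>) js R)"
        using R by (cases js rule: rev_cases) auto
    qed
  qed
  then show ?case by (simp add: Suc.IH)
qed simp

text \<open>
  A representative that is constant in \<open>x\<close> has vanishing derivatives.
\<close>

lemma jets_fst:
  assumes "open \<Omega>" "P (\<lambda>p\<in>U_dom \<Omega>. c (fst p))" "P (\<lambda>p\<in>U_dom \<Omega>. 0)"
  shows "jets \<Omega> P k (\<lambda>p\<in>U_dom \<Omega>. c (fst p))"
  using assms(2)
proof (induction k arbitrary: c)
  case (Suc k)
  have "jets \<Omega> P k (\<lambda>p\<in>U_dom \<Omega>. 0)" using assms(3) by (rule Suc.IH[of "\<lambda>_. 0"])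
  with Suc.prems show ?case by (simp only: jets.simps rep_partial_fst[OF assms(1)]) simp
qed simp

lemma jets_add:
  assumes "open \<Omega>" and add: "\<And>f g. P f \<Longrightarrow> P g \<Longrightarrow> P (\<lambda>p\<in>U_dom \<Omega>. f p + g p)"
  shows "R \<in> basic_space \<Omega> \<Longrightarrow> S \<in> basic_space \<Omega> \<Longrightarrow> jets \<Omega> P k R \<Longrightarrow> jets \<Omega> P k S
    \<Longrightarrow> jets \<Omega> P k (\<lambda>p\<in>U_dom \<Omega>. R p + S p)"
proof (induction k arbitrary: R S)
  case (Suc k)
  have "jets \<Omega> P k (rep_partial \<Omega> i (\<lambda>p\<in>U_dom \<Omega>. R p + S p))" for i
    unfolding rep_partial_add[OF assms(1) Suc.prems(1,2)]
    using Suc.prems by (intro Suc.IH rep_partial_basic_space assms(1)) simp_all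
  then show ?case using Suc.prems unfolding jets.simps by (blast intro: add)
qed (simp only: jets.simps add)

text \<open>
  The three properties are kept apart so that the lemma yields both that moderate functions are closed
  under products and that negligible ones absorb moderate factors.
\<close>

lemma jets_mult:
  assumes "open \<Omega>" and add: "\<And>f g. T f \<Longrightarrow> T g \<Longrightarrow> T (\<lambda>p\<in>U_dom \<Omega>. f p + g p)"
    and mult: "\<And>f g. P f \<Longrightarrow> Q g \<Longrightarrow> T (\<lambda>p\<in>U_dom \<Omega>. f p * g p)"
  shows "R \<in> basic_space \<Omega> \<Longrightarrow> S \<in> basic_space \<Omega> \<Longrightarrow> jets \<Omega> P k R \<Longrightarrow> jets \<Omega> Q k S
    \<Longrightarrow> jets \<Omega> T k (\<lambda>p\<in>U_dom \<Omega>. R p * S p)"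
proof (induction k arbitrary: R S)
  case (Suc k)
  have "jets \<Omega> T k (rep_partial \<Omega> i (\<lambda>p\<in>U_dom \<Omega>. R p * S p))" for i
    unfolding rep_partial_mult[OF assms(1) Suc.prems(1,2)]
    using Suc.prems jets_Suc_imp[OF Suc.prems(3)] jets_Suc_imp[OF Suc.prems(4)]
    by (intro jets_add[where P = T, OF assms(1) add] Suc.IH basic_space_mult rep_partial_basic_space assms(1))
       simp_all
  then show ?case using Suc.prems unfolding jets.simps by (blast intro: mult)
qed (simp only: jets.simps mult)

lemma jets_cnj:
  assumes "open \<Omega>" and "\<And>f. P f \<Longrightarrow> P (\<lambda>p\<in>U_dom \<Omega>. cnj (f p))"
  shows "R \<in> basic_space \<Omega> \<Longrightarrow> jets \<Omega> P k R \<Longrightarrow> jets \<Omega> P k (\<lambda>p\<in>U_dom \<Omega>. cnj (R p))"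
proof (induction k arbitrary: R)
  case (Suc k)
  have "jets \<Omega> P k (rep_partial \<Omega> i (\<lambda>p\<in>U_dom \<Omega>. cnj (R p)))" for i
    unfolding rep_partial_cnj[OF assms(1) Suc.prems(1)]
    using Suc.prems by (intro Suc.IH rep_partial_basic_space assms(1)) simp_all
  then show ?case using Suc.prems unfolding jets.simps by (blast intro: assms(2))
qed (simp only: jets.simps assms(2))

text \<open>
  The derivative of \<open>1/R\<close> is the product of \<open>-1\<close>, the derivative of \<open>R\<close> and two factors \<open>1/R\<close>. So the
  derivatives of \<open>1/R\<close> of order \<open>k + 1\<close> are controlled by those of order at most \<open>k\<close> together with the
  derivatives of \<open>R\<close>.
\<close>

lemma jets_inverse:
  assumes "open \<Omega>" and add: "\<And>f g. P f \<Longrightarrow> P g \<Longrightarrow> P (\<lambda>p\<in>U_dom \<Omega>. f p + g p)"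
    and mult: "\<And>f g. P f \<Longrightarrow> P g \<Longrightarrow> P (\<lambda>p\<in>U_dom \<Omega>. f p * g p)"
    and const: "\<And>c. P (\<lambda>p\<in>U_dom \<Omega>. c)"
    and R: "R \<in> basic_space \<Omega>" "\<And>p. p \<in> U_dom \<Omega> \<Longrightarrow> R p \<noteq> 0"
    and inv: "P (\<lambda>p\<in>U_dom \<Omega>. inverse (R p))"
  shows "jets \<Omega> P k R \<Longrightarrow> jets \<Omega> P k (\<lambda>p\<in>U_dom \<Omega>. inverse (R p))"
proof (induction k)
  case (Suc k)
  have "(\<lambda>p\<in>U_dom \<Omega>. inverse (R p)) \<in> basic_space \<Omega>"
    using assms(1) R by (rule basic_space_inverse)
  note basic = this rep_partial_basic_space[OF assms(1) R(1)]
    basic_space_mult[OF assms(1)] basic_space_fst[OF assms(1), of "\<lambda>_. - 1"]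
  have D: "rep_partial \<Omega> i (\<lambda>p\<in>U_dom \<Omega>. inverse (R p)) =
    (\<lambda>p\<in>U_dom \<Omega>. (\<lambda>p\<in>U_dom \<Omega>. (\<lambda>p\<in>U_dom \<Omega>. - 1) p * rep_partial \<Omega> i R p) p *
       (\<lambda>p\<in>U_dom \<Omega>. (\<lambda>p\<in>U_dom \<Omega>. inverse (R p)) p * (\<lambda>p\<in>U_dom \<Omega>. inverse (R p)) p) p)" for i
    by (rule rep_partial_inverse) (rule assms(1) R, assumption?)+
  have "jets \<Omega> P k (rep_partial \<Omega> i (\<lambda>p\<in>U_dom \<Omega>. inverse (R p)))" for i
    unfolding D
    using Suc.prems Suc.IH[OF jets_Suc_imp[OF Suc.prems]]
    by (intro jets_mult[where P = P and Q = P and T = P, OF assms(1) add mult] basic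
        jets_fst[OF assms(1), where c = "\<lambda>_. - 1"] const) simp_all
  then show ?case using inv by (simp only: jets.simps simp_thms)
qed (simp only: jets.simps inv)

section \<open>Growth in the scaling parameter\<close>

text \<open>
  Uniformly on \<open>K\<close>, the values at \<open>S\<^sub>\<epsilon> \<phi>\<close> are of order \<open>\<epsilon>\<^sup>k\<close>. Negative \<open>k\<close> permits blow-up as in
  moderateness, positive \<open>k\<close> demands decay as in negligibility.
\<close>

definition growth :: "(real^'n::finite) set \<Rightarrow> (real^'n \<Rightarrow> complex) \<Rightarrow> int \<Rightarrow> 'n rep \<Rightarrow> bool" where
  "growth K \<phi> k f \<longleftrightarrow>
     (\<exists>C. \<forall>\<^sub>F \<epsilon> in at_right 0. \<forall>x\<in>K. cmod (f (scale \<epsilon> \<phi>, x)) \<le> C * \<epsilon> powi k)"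

text \<open>
  The conditions of moderateness and negligibility on a single derivative.
\<close>

definition moderate_growth :: "(real^'n::finite) set \<Rightarrow> 'n rep \<Rightarrow> bool" where
  "moderate_growth \<Omega> f \<longleftrightarrow> (\<forall>K. compact K \<and> K \<subseteq> \<Omega> \<longrightarrow> (\<exists>N\<ge>1. \<forall>\<phi>\<in>mollifiers N. growth K \<phi> (- int N) f))"

definition negligible_growth :: "(real^'n::finite) set \<Rightarrow> 'n rep \<Rightarrow> bool" where
  "negligible_growth \<Omega> f \<longleftrightarrow> (\<forall>K. \<forall>m::nat. compact K \<and> K \<subseteq> \<Omega> \<and> 1 \<le> m \<longrightarrow>
     (\<exists>q\<ge>1. \<forall>\<phi>\<in>mollifiers q. growth K \<phi> (int m) f))"

lemma eventually_at_right_0_iff: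
  "(\<forall>\<^sub>F \<epsilon>::real in at_right 0. P \<epsilon>) \<longleftrightarrow> (\<exists>\<epsilon>\<^sub>0>0. \<forall>\<epsilon>. 0 < \<epsilon> \<and> \<epsilon> < \<epsilon>\<^sub>0 \<longrightarrow> P \<epsilon>)"
  by (auto simp: eventually_at_right_field)

lemma eventually_small: "0 < r \<Longrightarrow> \<forall>\<^sub>F \<epsilon>::real in at_right 0. 0 < \<epsilon> \<and> \<epsilon> < r"
  unfolding eventually_at_right_0_iff by blast

text \<open>
  The constant may be taken positive, which is what multiplying two such bounds requires.
\<close>

lemma growthE:
  assumes "growth K \<phi> k f"
  obtains C where "C > 0" "\<forall>\<^sub>F \<epsilon> in at_right 0. \<forall>x\<in>K. cmod (f (scale \<epsilon> \<phi>, x)) \<le> C * \<epsilon> powi k"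
proof -
  obtain C where C: "\<forall>\<^sub>F \<epsilon> in at_right 0. \<forall>x\<in>K. cmod (f (scale \<epsilon> \<phi>, x)) \<le> C * \<epsilon> powi k"
    using assms growth_def by blast
  have "\<forall>\<^sub>F \<epsilon> in at_right 0. \<forall>x\<in>K. cmod (f (scale \<epsilon> \<phi>, x)) \<le> max C 1 * \<epsilon> powi k"
    using C eventually_small[OF zero_less_one]
  proof eventually_elim
    case (elim \<epsilon>)
    have "C * \<epsilon> powi k \<le> max C 1 * \<epsilon> powi k"
      using elim by (intro mult_right_mono) (auto intro: less_imp_le zero_less_power_int)
    then show ?case using elim by (auto intro: order_trans)
  qed
  with that[of "max C 1"] show ?thesis by simp
qed

lemma growth_bound_mono:
  assumes "growth K \<phi> k f" "\<forall>\<^sub>F \<epsilon> in at_right 0. \<forall>x\<in>K. cmod (g (scale \<epsilon> \<phi>, x)) \<le> cmod (f (scale \<epsilon> \<phi>, x))"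
  shows "growth K \<phi> k g"
proof -
  obtain C where "\<forall>\<^sub>F \<epsilon> in at_right 0. \<forall>x\<in>K. cmod (f (scale \<epsilon> \<phi>, x)) \<le> C * \<epsilon> powi k"
    using assms(1) growth_def by blast
  with assms(2) have "\<forall>\<^sub>F \<epsilon> in at_right 0. \<forall>x\<in>K. cmod (g (scale \<epsilon> \<phi>, x)) \<le> C * \<epsilon> powi k"
    by eventually_elim (auto intro: order_trans)
  then show ?thesis unfolding growth_def by blast
qed

lemma growth_exponent_mono:
  assumes "growth K \<phi> k f" "l \<le> k"
  shows "growth K \<phi> l f"
proof -
  obtain C where C: "C > 0" "\<forall>\<^sub>F \<epsilon> in at_right 0. \<forall>x\<in>K. cmod (f (scale \<epsilon> \<phi>, x)) \<le> C * \<epsilon> powi k"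
    using growthE[OF assms(1)] by blast
  have "\<forall>\<^sub>F \<epsilon> in at_right 0. \<forall>x\<in>K. cmod (f (scale \<epsilon> \<phi>, x)) \<le> C * \<epsilon> powi l"
    using C(2) eventually_small[OF zero_less_one]
  proof eventually_elim
    case (elim \<epsilon>)
    have "C * \<epsilon> powi k \<le> C * \<epsilon> powi l"
      using elim C(1) assms(2) by (intro mult_left_mono power_int_decreasing) auto
    then show ?case using elim by (auto intro: order_trans)
  qed
  then show ?thesis unfolding growth_def by blast
qed

lemma growth_restrict:
  assumes "open \<Omega>" "compact K" "K \<subseteq> \<Omega>" "\<phi> \<in> mollifiers 0" "growth K \<phi> k f"
  shows "growth K \<phi> k (\<lambda>p\<in>U_dom \<Omega>. f p)"
  by (rule growth_bound_mono[OF assms(5)])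
     (use eventually_scale_in_U_dom[OF assms(1-4)] in \<open>eventually_elim, simp\<close>)

lemma growth_add:
  assumes "growth K \<phi> k f" "growth K \<phi> k g"
  shows "growth K \<phi> k (\<lambda>p. f p + g p)"
proof -
  obtain C D where
    "\<forall>\<^sub>F \<epsilon> in at_right 0. \<forall>x\<in>K. cmod (f (scale \<epsilon> \<phi>, x)) \<le> C * \<epsilon> powi k"
    "\<forall>\<^sub>F \<epsilon> in at_right 0. \<forall>x\<in>K. cmod (g (scale \<epsilon> \<phi>, x)) \<le> D * \<epsilon> powi k"
    using assms growth_def by blast
  then have "\<forall>\<^sub>F \<epsilon> in at_right 0. \<forall>x\<in>K. cmod (f (scale \<epsilon> \<phi>, x) + g (scale \<epsilon> \<phi>, x)) \<le> (C + D) * \<epsilon> powi k"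
    by eventually_elim (auto intro!: norm_triangle_le add_mono simp: distrib_right)
  then show ?thesis unfolding growth_def by blast
qed

lemma growth_mult:
  assumes "growth K \<phi> k f" "growth K \<phi> l g"
  shows "growth K \<phi> (k + l) (\<lambda>p. f p * g p)"
proof -
  obtain C where C: "C > 0" "\<forall>\<^sub>F \<epsilon> in at_right 0. \<forall>x\<in>K. cmod (f (scale \<epsilon> \<phi>, x)) \<le> C * \<epsilon> powi k"
    using growthE[OF assms(1)] by blast
  obtain D where D: "D > 0" "\<forall>\<^sub>F \<epsilon> in at_right 0. \<forall>x\<in>K. cmod (g (scale \<epsilon> \<phi>, x)) \<le> D * \<epsilon> powi l"
    using growthE[OF assms(2)] by blast
  have "\<forall>\<^sub>F \<epsilon> in at_right 0. \<forall>x\<in>K. cmod (f (scale \<epsilon> \<phi>, x) * g (scale \<epsilon> \<phi>, x)) \<le> (C * D) * \<epsilon> powi (k + l)"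
    using C(2) D(2) eventually_small[OF zero_less_one]
  proof eventually_elim
    case (elim \<epsilon>)
    have "cmod (f (scale \<epsilon> \<phi>, x) * g (scale \<epsilon> \<phi>, x)) \<le> (C * \<epsilon> powi k) * (D * \<epsilon> powi l)" if "x \<in> K" for x
      using elim that C(1) unfolding norm_mult
      by (intro mult_mono) (auto intro: less_imp_le zero_less_power_int)
    then show ?case using elim by (simp add: power_int_add mult_ac)
  qed
  then show ?thesis unfolding growth_def by blast
qed

lemma growth_const: "growth K \<phi> 0 (\<lambda>p. c)"
  unfolding growth_def by (rule exI[of _ "cmod c"]) simp

text \<open>
  Exponent and moment order may be found independently: the growth bound weakens with \<open>N\<close> and the set of
  mollifiers shrinks with \<open>q\<close>, so their maximum serves as both.
\<close>

lemma moderate_growthI: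
  assumes "\<And>K. compact K \<Longrightarrow> K \<subseteq> \<Omega> \<Longrightarrow> \<exists>N q. \<forall>\<phi>\<in>mollifiers q. growth K \<phi> (- int N) f"
  shows "moderate_growth \<Omega> f"
  unfolding moderate_growth_def
proof (intro allI impI)
  fix K assume "compact K \<and> K \<subseteq> \<Omega>"
  then obtain N q where "\<forall>\<phi>\<in>mollifiers q. growth K \<phi> (- int N) f" using assms by blast
  moreover define M where "M = max 1 (max N q)"
  ultimately have "\<forall>\<phi>\<in>mollifiers M. growth K \<phi> (- int M) f"
    using mollifiers_mono[of q M] growth_exponent_mono[of K _ "- int N" f "- int M"] by fastforce
  then show "\<exists>N\<ge>1. \<forall>\<phi>\<in>mollifiers N. growth K \<phi> (- int N) f"
    by (intro exI[of _ M]) (simp add: M_def)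
qed

lemma negligible_growthI:
  assumes "\<And>K m. compact K \<Longrightarrow> K \<subseteq> \<Omega> \<Longrightarrow> 1 \<le> m \<Longrightarrow> \<exists>q. \<forall>\<phi>\<in>mollifiers q. growth K \<phi> (int m) f"
  shows "negligible_growth \<Omega> f"
  unfolding negligible_growth_def
proof (intro allI impI)
  fix K m assume "compact K \<and> K \<subseteq> \<Omega> \<and> 1 \<le> (m::nat)"
  then obtain q where "\<forall>\<phi>\<in>mollifiers q. growth K \<phi> (int m) f" using assms by blast
  then show "\<exists>q\<ge>1. \<forall>\<phi>\<in>mollifiers q. growth K \<phi> (int m) f"
    using mollifiers_mono[of q "max 1 q"] by (intro exI[of _ "max 1 q"]) auto
qed

lemma moderate_growthE:
  assumes "moderate_growth \<Omega> f" "compact K" "K \<subseteq> \<Omega>"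
  obtains N where "\<forall>\<phi>\<in>mollifiers N. growth K \<phi> (- int N) f"
  using assms unfolding moderate_growth_def by blast

lemma negligible_growthE:
  assumes "negligible_growth \<Omega> f" "compact K" "K \<subseteq> \<Omega>" "1 \<le> m"
  obtains q where "\<forall>\<phi>\<in>mollifiers q. growth K \<phi> (int m) f"
  using assms unfolding negligible_growth_def by blast

lemma mollifiers_maxD:
  "\<phi> \<in> mollifiers (max p q) \<Longrightarrow> \<phi> \<in> mollifiers p \<and> \<phi> \<in> mollifiers q \<and> \<phi> \<in> mollifiers 0"
  using mollifiers_mono[of p "max p q"] mollifiers_mono[of q "max p q"]
    mollifiers_mono[of 0 "max p q"] by auto

lemma negligible_growth_imp_moderate_growth:
  assumes "negligible_growth \<Omega> f"
  shows "moderate_growth \<Omega> f"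
proof (rule moderate_growthI)
  fix K assume "compact K" "K \<subseteq> \<Omega>"
  then obtain q where "\<forall>\<phi>\<in>mollifiers q. growth K \<phi> (int 1) f"
    by (rule negligible_growthE[OF assms, of _ 1]) auto
  then show "\<exists>N q. \<forall>\<phi>\<in>mollifiers q. growth K \<phi> (- int N) f"
    by (intro exI[of _ 0] exI[of _ q]) (auto intro: growth_exponent_mono)
qed

lemma moderate_growth_add:
  assumes "open \<Omega>" "moderate_growth \<Omega> f" "moderate_growth \<Omega> g"
  shows "moderate_growth \<Omega> (\<lambda>p\<in>U_dom \<Omega>. f p + g p)"
proof (rule moderate_growthI)
  fix K assume K: "compact K" "K \<subseteq> \<Omega>"
  obtain M where M: "\<forall>\<phi>\<in>mollifiers M. growth K \<phi> (- int M) f" using moderate_growthE[OF assms(2) K] .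
  obtain N where N: "\<forall>\<phi>\<in>mollifiers N. growth K \<phi> (- int N) g" using moderate_growthE[OF assms(3) K] .
  have "growth K \<phi> (- int (max M N)) (\<lambda>p\<in>U_dom \<Omega>. f p + g p)" if "\<phi> \<in> mollifiers (max M N)" for \<phi>
    using mollifiers_maxD[OF that] M N
      growth_exponent_mono[of K \<phi> "- int M" f "- int (max M N)"]
      growth_exponent_mono[of K \<phi> "- int N" g "- int (max M N)"]
    by (intro growth_restrict growth_add K assms(1)) auto
  then show "\<exists>N q. \<forall>\<phi>\<in>mollifiers q. growth K \<phi> (- int N) (\<lambda>p\<in>U_dom \<Omega>. f p + g p)" by blast
qed

lemma moderate_growth_mult:
  assumes "open \<Omega>" "moderate_growth \<Omega> f" "moderate_growth \<Omega> g"
  shows "moderate_growth \<Omega> (\<lambda>p\<in>U_dom \<Omega>. f p * g p)"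
proof (rule moderate_growthI)
  fix K assume K: "compact K" "K \<subseteq> \<Omega>"
  obtain M where M: "\<forall>\<phi>\<in>mollifiers M. growth K \<phi> (- int M) f" using moderate_growthE[OF assms(2) K] .
  obtain N where N: "\<forall>\<phi>\<in>mollifiers N. growth K \<phi> (- int N) g" using moderate_growthE[OF assms(3) K] .
  have "growth K \<phi> (- int (M + N)) (\<lambda>p\<in>U_dom \<Omega>. f p * g p)" if "\<phi> \<in> mollifiers (max M N)" for \<phi>
    using mollifiers_maxD[OF that] M N growth_mult[of K \<phi> "- int M" f "- int N" g]
    by (intro growth_restrict K assms(1)) auto
  then show "\<exists>N q. \<forall>\<phi>\<in>mollifiers q. growth K \<phi> (- int N) (\<lambda>p\<in>U_dom \<Omega>. f p * g p)" by blast
qed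

lemma moderate_growth_const: "open \<Omega> \<Longrightarrow> moderate_growth \<Omega> (\<lambda>p\<in>U_dom \<Omega>. c)"
  by (rule moderate_growthI, rule exI[of _ 0], rule exI[of _ 0]) (auto intro!: growth_restrict growth_const)

lemma moderate_growth_cnj:
  assumes "open \<Omega>" "moderate_growth \<Omega> f"
  shows "moderate_growth \<Omega> (\<lambda>p\<in>U_dom \<Omega>. cnj (f p))"
proof (rule moderate_growthI)
  fix K assume K: "compact K" "K \<subseteq> \<Omega>"
  obtain N where N: "\<forall>\<phi>\<in>mollifiers N. growth K \<phi> (- int N) f" using moderate_growthE[OF assms(2) K] .
  have "growth K \<phi> (- int N) (\<lambda>p\<in>U_dom \<Omega>. cnj (f p))" if "\<phi> \<in> mollifiers N" for \<phi>
    using N that mollifiers_mono[of 0 N]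
    by (intro growth_restrict K assms(1) growth_bound_mono[of K \<phi> _ f "\<lambda>p. cnj (f p)"]) auto
  then show "\<exists>N q. \<forall>\<phi>\<in>mollifiers q. growth K \<phi> (- int N) (\<lambda>p\<in>U_dom \<Omega>. cnj (f p))" by blast
qed

lemma negligible_growth_add:
  assumes "open \<Omega>" "negligible_growth \<Omega> f" "negligible_growth \<Omega> g"
  shows "negligible_growth \<Omega> (\<lambda>p\<in>U_dom \<Omega>. f p + g p)"
proof (rule negligible_growthI)
  fix K and m :: nat assume K: "compact K" "K \<subseteq> \<Omega>" and m: "1 \<le> m"
  obtain p where p: "\<forall>\<phi>\<in>mollifiers p. growth K \<phi> (int m) f" using negligible_growthE[OF assms(2) K m] .
  obtain q where q: "\<forall>\<phi>\<in>mollifiers q. growth K \<phi> (int m) g" using negligible_growthE[OF assms(3) K m] .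
  have "growth K \<phi> (int m) (\<lambda>p\<in>U_dom \<Omega>. f p + g p)" if "\<phi> \<in> mollifiers (max p q)" for \<phi>
    using mollifiers_maxD[OF that] p q by (intro growth_restrict growth_add K assms(1)) auto
  then show "\<exists>q. \<forall>\<phi>\<in>mollifiers q. growth K \<phi> (int m) (\<lambda>p\<in>U_dom \<Omega>. f p + g p)" by blast
qed

text \<open>
  The loss \<open>\<epsilon>\<^bsup>-N\<^esup>\<close> of the moderate factor is compensated by asking for the power \<open>m + N\<close> from the negligible
  one.
\<close>

lemma negligible_growth_mult:
  assumes "open \<Omega>" "negligible_growth \<Omega> f" "moderate_growth \<Omega> g"
  shows "negligible_growth \<Omega> (\<lambda>p\<in>U_dom \<Omega>. f p * g p)"
proof (rule negligible_growthI)
  fix K and m :: nat assume K: "compact K" "K \<subseteq> \<Omega>" and m: "1 \<le> m"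
  obtain N where N: "\<forall>\<phi>\<in>mollifiers N. growth K \<phi> (- int N) g" using moderate_growthE[OF assms(3) K] .
  obtain q where q: "\<forall>\<phi>\<in>mollifiers q. growth K \<phi> (int (m + N)) f"
    using negligible_growthE[OF assms(2) K trans_le_add1[OF m]] .
  have "growth K \<phi> (int m) (\<lambda>p\<in>U_dom \<Omega>. f p * g p)" if "\<phi> \<in> mollifiers (max q N)" for \<phi>
    using mollifiers_maxD[OF that] q N growth_mult[of K \<phi> "int (m + N)" f "- int N" g]
    by (intro growth_restrict K assms(1)) auto
  then show "\<exists>q. \<forall>\<phi>\<in>mollifiers q. growth K \<phi> (int m) (\<lambda>p\<in>U_dom \<Omega>. f p * g p)" by blast
qed

lemma negligible_growth_zero: "open \<Omega> \<Longrightarrow> negligible_growth \<Omega> (\<lambda>p\<in>U_dom \<Omega>. 0)"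
proof (rule negligible_growthI, rule exI[of _ 0], rule ballI)
  fix K :: "(real^'a) set" and m and \<phi> :: "real^'a \<Rightarrow> complex"
  assume "open \<Omega>" "compact K" "K \<subseteq> \<Omega>" "\<phi> \<in> mollifiers 0"
  moreover have "growth K \<phi> (int m) (\<lambda>p. 0)"
    unfolding growth_def by (rule exI[of _ 0]) simp
  ultimately show "growth K \<phi> (int m) (\<lambda>p\<in>U_dom \<Omega>. 0)" by (rule growth_restrict)
qed

section \<open>Moderate and negligible representatives\<close>

text \<open>
  The strict bound on the supremum and the weak pointwise bound differ only by the size of the constant.
  Points of \<open>K\<close> are admissible for small \<open>\<epsilon>\<close>, so there the derivative of the slice is the value of the
  differentiated representative.
\<close>

lemma big_O_0_sup_deriv_iff:
  assumes "open \<Omega>" "R \<in> basic_space \<Omega>" "compact K" "K \<subseteq> \<Omega>" "\<phi> \<in> mollifiers 0"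
  shows "big_O_0 (sup_deriv R K \<alpha> \<phi>) (\<lambda>\<epsilon>. \<epsilon> powi k) \<longleftrightarrow>
    growth K \<phi> k (foldr (rep_partial \<Omega>) (index_list \<alpha>) R)" (is "?L \<longleftrightarrow> growth K \<phi> k ?D")
proof -
  have U: "\<forall>\<^sub>F \<epsilon> in at_right 0. \<forall>x\<in>K. (scale \<epsilon> \<phi>, x) \<in> U_dom \<Omega>"
    by (rule eventually_scale_in_U_dom[OF assms(1,3,4,5)])
  have sup: "sup_deriv R K \<alpha> \<phi> \<epsilon> = (SUP x\<in>K. ennreal (cmod (?D (scale \<epsilon> \<phi>, x))))"
    if "\<forall>x\<in>K. (scale \<epsilon> \<phi>, x) \<in> U_dom \<Omega>" for \<epsilon>
    unfolding sup_deriv_def using that by (simp add: multi_deriv_apply[OF assms(1,2)])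
  show ?thesis
  proof
    assume ?L
    then obtain C where C: "C > 0" "\<forall>\<^sub>F \<epsilon> in at_right 0. sup_deriv R K \<alpha> \<phi> \<epsilon> < ennreal (C * \<bar>\<epsilon> powi k\<bar>)"
      unfolding big_O_0_def eventually_at_right_0_iff by blast
    have "\<forall>\<^sub>F \<epsilon> in at_right 0. \<forall>x\<in>K. cmod (?D (scale \<epsilon> \<phi>, x)) \<le> C * \<epsilon> powi k"
      using C(2) U eventually_small[OF zero_less_one]
    proof eventually_elim
      case (elim \<epsilon>)
      show ?case
      proof
        fix x assume "x \<in> K"
        then have "ennreal (cmod (?D (scale \<epsilon> \<phi>, x))) \<le> sup_deriv R K \<alpha> \<phi> \<epsilon>"
          unfolding sup[OF elim(2)] by (rule SUP_upper)
        also have "\<dots> < ennreal (C * \<bar>\<epsilon> powi k\<bar>)" by (rule elim)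
        finally show "cmod (?D (scale \<epsilon> \<phi>, x)) \<le> C * \<epsilon> powi k"
          using elim(3) C(1) by (simp add: ennreal_less_iff abs_of_pos zero_less_power_int)
      qed
    qed
    then show "growth K \<phi> k ?D" unfolding growth_def by blast
  next
    assume "growth K \<phi> k ?D"
    then obtain C where C: "C > 0" "\<forall>\<^sub>F \<epsilon> in at_right 0. \<forall>x\<in>K. cmod (?D (scale \<epsilon> \<phi>, x)) \<le> C * \<epsilon> powi k"
      by (rule growthE)
    have "\<forall>\<^sub>F \<epsilon> in at_right 0. sup_deriv R K \<alpha> \<phi> \<epsilon> < ennreal ((C + 1) * \<bar>\<epsilon> powi k\<bar>)"
      using C(2) U eventually_small[OF zero_less_one]
    proof eventually_elim
      case (elim \<epsilon>)
      have pos: "0 < \<epsilon> powi k" using elim by (simp add: zero_less_power_int)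
      have "sup_deriv R K \<alpha> \<phi> \<epsilon> \<le> ennreal (C * \<epsilon> powi k)"
        unfolding sup[OF elim(2)] using elim(1) by (intro SUP_least ennreal_leI) auto
      also have "\<dots> < ennreal ((C + 1) * \<bar>\<epsilon> powi k\<bar>)"
        using pos C(1) by (intro ennreal_lessI) (auto simp: distrib_right intro: add_pos_pos)
      finally show ?case .
    qed
    then show ?L unfolding big_O_0_def eventually_at_right_0_iff
      using C(1) by (intro exI[of _ "C + 1"]) auto
  qed
qed

text \<open>
  The multi-index that counts the entries of a list gives the same derivative as the list itself.
\<close>

lemma all_jets_iff:
  assumes "open \<Omega>" "R \<in> basic_space \<Omega>"
  shows "(\<forall>k. jets \<Omega> P k R) \<longleftrightarrow> (\<forall>\<alpha>. P (foldr (rep_partial \<Omega>) (index_list \<alpha>) R))"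
proof -
  have "(\<forall>k. jets \<Omega> P k R) \<longleftrightarrow> (\<forall>js. P (foldr (rep_partial \<Omega>) js R))"
    unfolding jets_iff_foldr by blast
  also have "\<dots> \<longleftrightarrow> (\<forall>\<alpha>. P (foldr (rep_partial \<Omega>) (index_list \<alpha>) R))"
  proof safe
    fix js assume "\<forall>\<alpha>. P (foldr (rep_partial \<Omega>) (index_list \<alpha>) R)"
    then show "P (foldr (rep_partial \<Omega>) js R)" by (subst foldr_rep_partial_index_list[OF assms]) blast
  qed blast
  finally show ?thesis .
qed

lemma moderate_iff:
  assumes "open \<Omega>"
  shows "R \<in> moderate \<Omega> \<longleftrightarrow> R \<in> basic_space \<Omega> \<and> (\<forall>k. jets \<Omega> (moderate_growth \<Omega>) k R)"
proof (cases "R \<in> basic_space \<Omega>")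
  case True
  have "(\<forall>\<phi>\<in>mollifiers N. big_O_0 (sup_deriv R K \<alpha> \<phi>) (\<lambda>\<epsilon>. \<epsilon> powi (- int N)))
      \<longleftrightarrow> (\<forall>\<phi>\<in>mollifiers N. growth K \<phi> (- int N) (foldr (rep_partial \<Omega>) (index_list \<alpha>) R))"
    if "compact K" "K \<subseteq> \<Omega>" for K \<alpha> N
    using big_O_0_sup_deriv_iff[OF assms True that] mollifiers_mono[of 0 N] by blast
  then have "R \<in> moderate \<Omega> \<longleftrightarrow> (\<forall>\<alpha>. moderate_growth \<Omega> (foldr (rep_partial \<Omega>) (index_list \<alpha>) R))"
    using True unfolding moderate_def moderate_growth_def by auto
  then show ?thesis using True all_jets_iff[OF assms True] by simp
qed (simp add: moderate_def)

lemma negligible_reps_iff: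
  assumes "open \<Omega>"
  shows "R \<in> negligible_reps \<Omega> \<longleftrightarrow> R \<in> basic_space \<Omega> \<and> (\<forall>k. jets \<Omega> (negligible_growth \<Omega>) k R)"
proof (cases "R \<in> basic_space \<Omega>")
  case True
  have "(\<forall>\<phi>\<in>mollifiers q. big_O_0 (sup_deriv R K \<alpha> \<phi>) (\<lambda>\<epsilon>. \<epsilon> ^ m))
      \<longleftrightarrow> (\<forall>\<phi>\<in>mollifiers q. growth K \<phi> (int m) (foldr (rep_partial \<Omega>) (index_list \<alpha>) R))"
    if "compact K" "K \<subseteq> \<Omega>" for K \<alpha> q m
    using big_O_0_sup_deriv_iff[OF assms True that, where k = "int m"] mollifiers_mono[of 0 q] by auto
  then have "R \<in> negligible_reps \<Omega> \<longleftrightarrow> (\<forall>\<alpha>. negligible_growth \<Omega> (foldr (rep_partial \<Omega>) (index_list \<alpha>) R))"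
    using True unfolding negligible_reps_def negligible_growth_def by auto
  then show ?thesis using True all_jets_iff[OF assms True] by simp
qed (simp add: negligible_reps_def)

lemma moderate_basic: "R \<in> moderate \<Omega> \<Longrightarrow> R \<in> basic_space \<Omega>"
  by (simp add: moderate_def)

lemma moderate_imp_moderate_growth: "open \<Omega> \<Longrightarrow> R \<in> moderate \<Omega> \<Longrightarrow> moderate_growth \<Omega> R"
  using moderate_iff jets_imp by blast

lemma negligible_reps_imp_negligible_growth: "open \<Omega> \<Longrightarrow> R \<in> negligible_reps \<Omega> \<Longrightarrow> negligible_growth \<Omega> R"
  using negligible_reps_iff jets_imp by blast

lemma negligible_imp_moderate: "open \<Omega> \<Longrightarrow> R \<in> negligible_reps \<Omega> \<Longrightarrow> R \<in> moderate \<Omega>"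
  unfolding moderate_iff negligible_reps_iff using jets_mono[of "negligible_growth \<Omega>" "moderate_growth \<Omega>"] negligible_growth_imp_moderate_growth by blast

lemma moderate_add:
  assumes "open \<Omega>" "R \<in> moderate \<Omega>" "S \<in> moderate \<Omega>"
  shows "(\<lambda>p\<in>U_dom \<Omega>. R p + S p) \<in> moderate \<Omega>"
  using assms(2,3) unfolding moderate_iff[OF assms(1)]
  by (blast intro: basic_space_add[OF assms(1)] jets_add[where P = "moderate_growth \<Omega>", OF assms(1) moderate_growth_add[OF assms(1)]])

lemma moderate_mult:
  assumes "open \<Omega>" "R \<in> moderate \<Omega>" "S \<in> moderate \<Omega>"
  shows "(\<lambda>p\<in>U_dom \<Omega>. R p * S p) \<in> moderate \<Omega>"
  using assms(2,3) unfolding moderate_iff[OF assms(1)]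
  by (blast intro: basic_space_mult[OF assms(1)] jets_mult[where P = "moderate_growth \<Omega>" and Q = "moderate_growth \<Omega>" and T = "moderate_growth \<Omega>",
        OF assms(1) moderate_growth_add[OF assms(1)] moderate_growth_mult[OF assms(1)]])

lemma moderate_cnj:
  assumes "open \<Omega>" "R \<in> moderate \<Omega>"
  shows "(\<lambda>p\<in>U_dom \<Omega>. cnj (R p)) \<in> moderate \<Omega>"
  using assms(2) unfolding moderate_iff[OF assms(1)]
  by (blast intro: basic_space_cnj[OF assms(1)] jets_cnj[where P = "moderate_growth \<Omega>", OF assms(1) moderate_growth_cnj[OF assms(1)]])

lemma moderate_const:
  assumes "open \<Omega>"
  shows "(\<lambda>p\<in>U_dom \<Omega>. c) \<in> moderate \<Omega>"
  using basic_space_fst[OF assms, of "\<lambda>_. c"]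
    jets_fst[where P = "moderate_growth \<Omega>" and c = "\<lambda>_. c", OF assms moderate_growth_const[OF assms] moderate_growth_const[OF assms]]
  unfolding moderate_iff[OF assms] by blast

lemma negligible_reps_add:
  assumes "open \<Omega>" "R \<in> negligible_reps \<Omega>" "S \<in> negligible_reps \<Omega>"
  shows "(\<lambda>p\<in>U_dom \<Omega>. R p + S p) \<in> negligible_reps \<Omega>"
  using assms(2,3) unfolding negligible_reps_iff[OF assms(1)]
  by (blast intro: basic_space_add[OF assms(1)] jets_add[where P = "negligible_growth \<Omega>", OF assms(1) negligible_growth_add[OF assms(1)]])

lemma negligible_reps_mult:
  assumes "open \<Omega>" "R \<in> negligible_reps \<Omega>" "S \<in> moderate \<Omega>"
  shows "(\<lambda>p\<in>U_dom \<Omega>. R p * S p) \<in> negligible_reps \<Omega>"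
  using assms(2,3) unfolding negligible_reps_iff[OF assms(1)] moderate_iff[OF assms(1)]
  by (blast intro: basic_space_mult[OF assms(1)] jets_mult[where P = "negligible_growth \<Omega>" and Q = "moderate_growth \<Omega>" and T = "negligible_growth \<Omega>",
        OF assms(1) negligible_growth_add[OF assms(1)] negligible_growth_mult[OF assms(1)]])

lemma negligible_reps_fst:
  assumes "open \<Omega>" "negligible_growth \<Omega> (\<lambda>p\<in>U_dom \<Omega>. c (fst p))"
  shows "(\<lambda>p\<in>U_dom \<Omega>. c (fst p)) \<in> negligible_reps \<Omega>"
  using basic_space_fst[OF assms(1), of c]
    jets_fst[where P = "negligible_growth \<Omega>" and c = c, OF assms(1,2) negligible_growth_zero[OF assms(1)]]
  unfolding negligible_reps_iff[OF assms(1)] by blast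

section \<open>Invertibility in the quotient ring\<close>

lemma cring_moderate_ring:
  assumes "open \<Omega>"
  shows "cring (moderate_ring \<Omega>)"
proof (rule cringI)
  have ext: "\<And>R p. R \<in> moderate \<Omega> \<Longrightarrow> p \<notin> U_dom \<Omega> \<Longrightarrow> R p = undefined"
    by (auto simp: moderate_def basic_space_def extensional_def)
  show "abelian_group (moderate_ring \<Omega>)"
  proof (rule abelian_groupI)
    fix R assume R: "R \<in> carrier (moderate_ring \<Omega>)"
    have "(\<lambda>p\<in>U_dom \<Omega>. (\<lambda>p\<in>U_dom \<Omega>. - 1) p * R p) \<in> moderate \<Omega>"
      using R by (intro moderate_mult moderate_const assms) (simp add: moderate_ring_def)
    then show "\<exists>S\<in>carrier (moderate_ring \<Omega>). S \<oplus>\<^bsub>moderate_ring \<Omega>\<^esub> R = \<zero>\<^bsub>moderate_ring \<Omega>\<^esub>"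
      by (intro bexI[of _ "\<lambda>p\<in>U_dom \<Omega>. (\<lambda>p\<in>U_dom \<Omega>. - 1) p * R p"])
         (auto simp: moderate_ring_def fun_eq_iff)
  qed (auto simp: moderate_ring_def fun_eq_iff ext intro!: moderate_add moderate_const assms)
  show "comm_monoid (moderate_ring \<Omega>)"
    by (rule comm_monoidI)
       (auto simp: moderate_ring_def fun_eq_iff ext intro!: moderate_mult moderate_const assms)
qed (auto simp: moderate_ring_def fun_eq_iff distrib_right)

lemma moderate_ring_minus:
  assumes "open \<Omega>" "R \<in> moderate \<Omega>" "S \<in> moderate \<Omega>"
  shows "R \<ominus>\<^bsub>moderate_ring \<Omega>\<^esub> S = (\<lambda>p\<in>U_dom \<Omega>. R p - S p)"
proof -
  interpret cring "moderate_ring \<Omega>" by (rule cring_moderate_ring[OF assms(1)])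
  have "(\<lambda>p\<in>U_dom \<Omega>. (\<lambda>p\<in>U_dom \<Omega>. - 1) p * S p) \<in> moderate \<Omega>"
    by (intro moderate_mult moderate_const assms)
  then have "\<ominus>\<^bsub>moderate_ring \<Omega>\<^esub> S = (\<lambda>p\<in>U_dom \<Omega>. (\<lambda>p\<in>U_dom \<Omega>. - 1) p * S p)"
    using assms(3) by (intro minus_equality) (auto simp: moderate_ring_def fun_eq_iff)
  then show ?thesis by (auto simp: a_minus_def moderate_ring_def fun_eq_iff)
qed

lemma ideal_negligible_reps:
  assumes "open \<Omega>"
  shows "ideal (negligible_reps \<Omega>) (moderate_ring \<Omega>)"
proof -
  interpret cring "moderate_ring \<Omega>" by (rule cring_moderate_ring[OF assms])
  have closed: "R \<otimes>\<^bsub>moderate_ring \<Omega>\<^esub> S \<in> negligible_reps \<Omega>"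
    if "R \<in> negligible_reps \<Omega>" "S \<in> carrier (moderate_ring \<Omega>)" for R S
    using that negligible_reps_mult[OF assms] by (simp add: moderate_ring_def)
  have sub: "R \<in> carrier (moderate_ring \<Omega>)" if "R \<in> negligible_reps \<Omega>" for R
    using negligible_imp_moderate[OF assms that] by (simp add: moderate_ring_def)
  show ?thesis
  proof (rule idealI[OF ring_axioms])
    show "subgroup (negligible_reps \<Omega>) (add_monoid (moderate_ring \<Omega>))"
    proof (rule add.subgroupI)
      show "negligible_reps \<Omega> \<noteq> {}"
        using negligible_reps_fst[OF assms, of "\<lambda>_. 0"] negligible_growth_zero[OF assms] by blast
      fix R assume R: "R \<in> negligible_reps \<Omega>"
      have "\<ominus>\<^bsub>moderate_ring \<Omega>\<^esub> R = R \<otimes>\<^bsub>moderate_ring \<Omega>\<^esub> (\<ominus>\<^bsub>moderate_ring \<Omega>\<^esub> \<one>\<^bsub>moderate_ring \<Omega>\<^esub>)"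
        using sub[OF R] by (simp add: r_minus)
      then show "\<ominus>\<^bsub>moderate_ring \<Omega>\<^esub> R \<in> negligible_reps \<Omega>"
        using closed[OF R] by simp
    next
      fix R S assume "R \<in> negligible_reps \<Omega>" "S \<in> negligible_reps \<Omega>"
      then show "R \<oplus>\<^bsub>moderate_ring \<Omega>\<^esub> S \<in> negligible_reps \<Omega>"
        using negligible_reps_add[OF assms] by (simp add: moderate_ring_def)
    qed (use sub in auto)
  qed (use closed sub m_comm in auto)
qed

text \<open>
  Every coset has a representative, so being a unit of the quotient is invertibility modulo the ideal.
\<close>

lemma (in cring) Units_Quot_iff:
  assumes "ideal I R" "a \<in> carrier R"
  shows "I +> a \<in> Units (R Quot I) \<longleftrightarrow> (\<exists>b\<in>carrier R. a \<otimes> b \<ominus> \<one> \<in> I)"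
proof -
  interpret ideal I R by fact
  interpret Q: cring "R Quot I" by (rule quotient_is_cring) (rule cring_axioms)
  have carrier: "carrier (R Quot I) = (\<lambda>b. I +> b) ` carrier R"
    by (auto simp: FactRing_simps)
  have mult: "(I +> a) \<otimes>\<^bsub>R Quot I\<^esub> (I +> b) = I +> (a \<otimes> b)" if "b \<in> carrier R" for b
    using assms(2) that by (simp add: FactRing_def rcoset_mult_add)
  have one: "\<one>\<^bsub>R Quot I\<^esub> = I +> \<one>" by (simp add: FactRing_def)
  have "I +> a \<in> Units (R Quot I) \<longleftrightarrow>
      (\<exists>B\<in>carrier (R Quot I). (I +> a) \<otimes>\<^bsub>R Quot I\<^esub> B = \<one>\<^bsub>R Quot I\<^esub>)"
    using assms(2) carrier Q.m_comm unfolding Units_def by auto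
  also have "\<dots> \<longleftrightarrow> (\<exists>b\<in>carrier R. I +> (a \<otimes> b) = I +> \<one>)"
    unfolding carrier one using mult by auto
  also have "\<dots> \<longleftrightarrow> (\<exists>b\<in>carrier R. a \<otimes> b \<ominus> \<one> \<in> I)"
    using assms quotient_eq_iff_same_a_r_cos by auto
  finally show ?thesis .
qed

lemma gen_fun_ring_repD:
  assumes "open \<Omega>" "Rt \<in> carrier (gen_fun_ring \<Omega>)"
  shows "Rt \<noteq> {}"
    and "R \<in> Rt \<Longrightarrow> R \<in> moderate \<Omega> \<and> Rt = negligible_reps \<Omega> +>\<^bsub>moderate_ring \<Omega>\<^esub> R"
proof -
  interpret cring "moderate_ring \<Omega>" by (rule cring_moderate_ring[OF assms(1)])
  interpret ideal "negligible_reps \<Omega>" "moderate_ring \<Omega>" by (rule ideal_negligible_reps[OF assms(1)])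
  obtain S where S: "S \<in> carrier (moderate_ring \<Omega>)" "Rt = negligible_reps \<Omega> +>\<^bsub>moderate_ring \<Omega>\<^esub> S"
    using assms(2) by (auto simp: gen_fun_ring_def FactRing_def A_RCOSETS_def')
  show "Rt \<noteq> {}" using a_rcos_self[OF S(1)] S(2) by blast
  assume R: "R \<in> Rt"
  have "Rt \<subseteq> carrier (moderate_ring \<Omega>)"
    using assms(2) a_rcosets_carrier by (simp add: gen_fun_ring_def FactRing_def)
  then show "R \<in> moderate \<Omega> \<and> Rt = negligible_reps \<Omega> +>\<^bsub>moderate_ring \<Omega>\<^esub> R"
    using R S a_repr_independence' by (auto simp: moderate_ring_def)
qed

lemma Units_gen_fun_ring_iff:
  assumes "open \<Omega>" "Rt \<in> carrier (gen_fun_ring \<Omega>)" "R \<in> Rt"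
  shows "Rt \<in> Units (gen_fun_ring \<Omega>) \<longleftrightarrow>
    (\<exists>S\<in>moderate \<Omega>. (\<lambda>p\<in>U_dom \<Omega>. R p * S p - 1) \<in> negligible_reps \<Omega>)"
proof -
  interpret cring "moderate_ring \<Omega>" by (rule cring_moderate_ring[OF assms(1)])
  have R: "R \<in> moderate \<Omega>" "Rt = negligible_reps \<Omega> +>\<^bsub>moderate_ring \<Omega>\<^esub> R"
    using gen_fun_ring_repD(2)[OF assms] by auto
  have "R \<otimes>\<^bsub>moderate_ring \<Omega>\<^esub> S \<ominus>\<^bsub>moderate_ring \<Omega>\<^esub> \<one>\<^bsub>moderate_ring \<Omega>\<^esub> = (\<lambda>p\<in>U_dom \<Omega>. R p * S p - 1)"
    if "S \<in> moderate \<Omega>" for S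
  proof -
    have "R \<otimes>\<^bsub>moderate_ring \<Omega>\<^esub> S \<in> moderate \<Omega>" "\<one>\<^bsub>moderate_ring \<Omega>\<^esub> \<in> moderate \<Omega>"
      using R(1) that moderate_mult moderate_const assms(1) by (auto simp: moderate_ring_def)
    then have "R \<otimes>\<^bsub>moderate_ring \<Omega>\<^esub> S \<ominus>\<^bsub>moderate_ring \<Omega>\<^esub> \<one>\<^bsub>moderate_ring \<Omega>\<^esub>
        = (\<lambda>p\<in>U_dom \<Omega>. (R \<otimes>\<^bsub>moderate_ring \<Omega>\<^esub> S) p - \<one>\<^bsub>moderate_ring \<Omega>\<^esub> p)"
      by (rule moderate_ring_minus[OF assms(1)])
    then show ?thesis by (auto simp: moderate_ring_def fun_eq_iff)
  qed
  then show ?thesis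
    using Units_Quot_iff[OF ideal_negligible_reps[OF assms(1)], of R] R
    by (simp add: gen_fun_ring_def) (simp add: moderate_ring_def)
qed

section \<open>A strictly positive negligible function\<close>

definition sup_norm :: "(real^'n::finite \<Rightarrow> complex) \<Rightarrow> real" where
  "sup_norm \<phi> = (SUP y. cmod (\<phi> y))"

lemma mollifier_le_sup_norm:
  assumes "\<phi> \<in> mollifiers 0"
  shows "cmod (\<phi> y) \<le> sup_norm \<phi>"
proof -
  have "continuous_on UNIV \<phi>" "compact (supp \<phi>)"
    using assms Ck_on.simps(1) unfolding mollifiers_def test_functions_def smooth_on_def by blast+
  then have "bounded (\<phi> ` supp \<phi>)"
    by (meson compact_continuous_image compact_imp_bounded continuous_on_subset subset_UNIV)
  then obtain B where B: "B > 0" "\<And>y. y \<in> supp \<phi> \<Longrightarrow> cmod (\<phi> y) \<le> B"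
    unfolding bounded_pos by blast
  have "cmod (\<phi> y) \<le> B" for y
    using B closure_subset[of "{x. \<phi> x \<noteq> 0}"] by (cases "\<phi> y = 0") (auto simp: supp_def)
  then have "bdd_above (range (\<lambda>y. cmod (\<phi> y)))" by (rule bdd_aboveI2)
  then show ?thesis unfolding sup_norm_def by (rule cSUP_upper2) auto
qed

text \<open>
  The supremum is multiplied by \<open>\<epsilon>\<^bsup>-n\<^esup>\<close>, with \<open>n \<ge> 1\<close>, and it is positive since the integral of a mollifier
  is 1.
\<close>

lemma sup_norm_scale_ge:
  fixes \<phi> :: "real^'n::finite \<Rightarrow> complex"
  assumes "\<phi> \<in> mollifiers 0"
  obtains c where "c > 0" "\<And>\<epsilon>. 0 < \<epsilon> \<Longrightarrow> \<epsilon> < 1 \<Longrightarrow> c / \<epsilon> \<le> sup_norm (scale \<epsilon> \<phi>)"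
proof -
  have "\<exists>y. \<phi> y \<noteq> 0"
  proof (rule ccontr)
    assume "\<not> ?thesis"
    then have "\<phi> = (\<lambda>_. 0)" by auto
    then show False using assms by (simp add: mollifiers_def)
  qed
  then obtain y where y: "\<phi> y \<noteq> 0" by blast
  have "cmod (\<phi> y) / \<epsilon> \<le> sup_norm (scale \<epsilon> \<phi>)" if \<epsilon>: "0 < \<epsilon>" "\<epsilon> < 1" for \<epsilon>
  proof -
    have "\<epsilon> ^ CARD('n) \<le> \<epsilon> ^ 1"
      using \<epsilon> by (intro power_decreasing) (auto simp: Suc_le_eq)
    then have "cmod (\<phi> y) / \<epsilon> \<le> cmod (\<phi> y) / \<epsilon> ^ CARD('n)"
      using \<epsilon> by (intro divide_left_mono) auto
    also have "\<dots> = cmod (scale \<epsilon> \<phi> (\<epsilon> *\<^sub>R y))"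
      using \<epsilon> by (simp add: scale_def norm_power divide_inverse mult.commute)
    also have "\<dots> \<le> sup_norm (scale \<epsilon> \<phi>)"
      by (rule mollifier_le_sup_norm[OF scale_in_mollifiers[OF \<epsilon>(1) assms]])
    finally show ?thesis .
  qed
  with y that[of "cmod (\<phi> y)"] show ?thesis by simp
qed

text \<open>
  The perturbation \<open>\<delta>\<close> of the denominator: exponentially small in \<open>1/\<epsilon>\<close> along \<open>S\<^sub>\<epsilon> \<phi>\<close>, yet never zero.
\<close>

definition damping :: "(real^'n::finite \<Rightarrow> complex) \<Rightarrow> real" where
  "damping \<phi> = exp (- sup_norm \<phi>)"

text \<open>
  \<open>exp u = exp (u/m)\<^sup>m \<ge> (u/m)\<^sup>m\<close>.
\<close>

lemma exp_minus_le_power: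
  assumes "0 < u" "1 \<le> m"
  shows "exp (- u) \<le> (real m / u) ^ m"
proof -
  have "(u / real m) ^ m \<le> exp (u / real m) ^ m"
    using assms less_imp_le[OF exp_gt_self[of "u / real m"]] by (intro power_mono) simp_all
  also have "\<dots> = exp u" using assms by (simp add: exp_of_nat_mult[symmetric])
  finally have "inverse (exp u) \<le> inverse ((u / real m) ^ m)"
    using assms by (intro le_imp_inverse_le) auto
  then show ?thesis by (simp add: exp_minus power_inverse[symmetric])
qed

lemma damping_negligible:
  assumes "open \<Omega>"
  shows "(\<lambda>p\<in>U_dom \<Omega>. of_real (damping (fst p))) \<in> negligible_reps \<Omega>"
proof (rule negligible_reps_fst[OF assms], rule negligible_growthI, rule exI[of _ 0], rule ballI)
  fix K :: "(real^'a) set" and m :: nat and \<phi> :: "real^'a \<Rightarrow> complex"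
  assume K: "compact K" "K \<subseteq> \<Omega>" and m: "1 \<le> m" and \<phi>: "\<phi> \<in> mollifiers 0"
  obtain c where c: "c > 0" "\<And>\<epsilon>. 0 < \<epsilon> \<Longrightarrow> \<epsilon> < 1 \<Longrightarrow> c / \<epsilon> \<le> sup_norm (scale \<epsilon> \<phi>)"
    using sup_norm_scale_ge[OF \<phi>] by blast
  have "\<forall>\<^sub>F \<epsilon> in at_right 0. \<forall>x\<in>K. cmod (of_real (damping (fst (scale \<epsilon> \<phi>, x)))) \<le> (real m / c) ^ m * \<epsilon> powi int m"
    using eventually_small[OF zero_less_one]
  proof eventually_elim
    case (elim \<epsilon>)
    have "damping (scale \<epsilon> \<phi>) \<le> exp (- (c / \<epsilon>))"
      using c(2) elim by (simp add: damping_def)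
    also have "\<dots> \<le> (real m / (c / \<epsilon>)) ^ m" using elim c m by (intro exp_minus_le_power) auto
    also have "\<dots> = (real m / c) ^ m * \<epsilon> powi int m"
      by (simp add: power_mult_distrib[symmetric])
    finally show ?case by (simp add: damping_def)
  qed
  then have "growth K \<phi> (int m) (\<lambda>p. of_real (damping (fst p)))" unfolding growth_def by blast
  then show "growth K \<phi> (int m) (\<lambda>p\<in>U_dom \<Omega>. of_real (damping (fst p)))"
    by (rule growth_restrict[OF assms K \<phi>])
qed

section \<open>Lower bounds and invertibility\<close>

text \<open>
  The condition of the theorem in its loosest form, pointwise and with weak inequality; it turns out to be
  equivalent to each of the sharper forms.
\<close>

definition bounded_below :: "(real^'n::finite) set \<Rightarrow> 'n rep \<Rightarrow> bool" where
  "bounded_below \<Omega> R \<longleftrightarrow> (\<forall>K. compact K \<and> K \<subseteq> \<Omega> \<longrightarrow>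
     (\<exists>(m::nat) q. \<forall>\<phi>\<in>mollifiers q. \<exists>C>0. \<forall>\<^sub>F \<epsilon> in at_right 0.
        \<forall>x\<in>K. C * \<epsilon> ^ m \<le> cmod (R (scale \<epsilon> \<phi>, x))))"

lemma bounded_belowE:
  assumes "bounded_below \<Omega> R" "compact K" "K \<subseteq> \<Omega>"
  obtains m q where "\<And>\<phi>. \<phi> \<in> mollifiers q \<Longrightarrow> \<exists>C>0. \<forall>\<^sub>F \<epsilon> in at_right 0.
        \<forall>x\<in>K. C * \<epsilon> ^ m \<le> cmod (R (scale \<epsilon> \<phi>, x))"
  using assms unfolding bounded_below_def by meson

lemma inf_exceedsD:
  assumes "inf_exceeds R K \<phi> C m \<epsilon>" "x \<in> K" 
  shows "C * \<epsilon> ^ m \<le> cmod (R (scale \<epsilon> \<phi>, x))"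
proof -
  have "ennreal (C * \<epsilon> ^ m) < (INF x\<in>K. ennreal (cmod (R (scale \<epsilon> \<phi>, x))))"
    using assms(1) by (simp add: inf_exceeds_def)
  also have "\<dots> \<le> ennreal (cmod (R (scale \<epsilon> \<phi>, x)))" using assms(2) by (rule INF_lower)
  finally have "\<not> ennreal (cmod (R (scale \<epsilon> \<phi>, x))) \<le> ennreal (C * \<epsilon> ^ m)" by (simp add: not_le)
  then show ?thesis using ennreal_leI linear by blast
qed

text \<open>
  A uniform bound \<open>B\<close> bounds the infimum only weakly, hence the gap between \<open>C \<epsilon>\<^sup>m\<close> and \<open>B\<close>.
\<close>

lemma inf_exceedsI:
  assumes "\<And>x. x \<in> K \<Longrightarrow> B \<le> cmod (R (scale \<epsilon> \<phi>, x))" "C * \<epsilon> ^ m < B" "0 < B"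
  shows "inf_exceeds R K \<phi> C m \<epsilon>"
proof -
  have "ennreal (C * \<epsilon> ^ m) < ennreal B" using assms(2,3) by (intro ennreal_lessI)
  also have "\<dots> \<le> (INF x\<in>K. ennreal (cmod (R (scale \<epsilon> \<phi>, x))))"
    using assms(1) by (intro INF_greatest ennreal_leI)
  finally show ?thesis by (simp add: inf_exceeds_def)
qed

lemma bounded_below_if_inf_exceeds:
  fixes \<Omega> :: "(real^'n::finite) set" and R :: "'n rep"
  assumes "\<And>K. compact K \<and> K \<subseteq> \<Omega> \<Longrightarrow> \<exists>(m::nat) q. \<forall>\<phi>\<in>mollifiers q. \<exists>C>0.
    \<forall>\<^sub>F \<epsilon> in at_right 0. inf_exceeds R K \<phi> C m \<epsilon>"
  shows "bounded_below \<Omega> R"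
  unfolding bounded_below_def
proof (intro allI impI)
  fix K :: "(real^'n) set" assume "compact K \<and> K \<subseteq> \<Omega>"
  from assms[OF this] obtain m q where
    mq: "\<And>\<phi>. \<phi> \<in> mollifiers q \<Longrightarrow> \<exists>C>0. \<forall>\<^sub>F \<epsilon> in at_right 0. inf_exceeds R K \<phi> C m \<epsilon>" by blast
  have "\<exists>C>0. \<forall>\<^sub>F \<epsilon> in at_right 0. \<forall>x\<in>K. C * \<epsilon> ^ m \<le> cmod (R (scale \<epsilon> \<phi>, x))"
    if \<phi>: "\<phi> \<in> mollifiers q" for \<phi>
  proof -
    obtain C where C: "C > 0" "\<forall>\<^sub>F \<epsilon> in at_right 0. inf_exceeds R K \<phi> C m \<epsilon>"
      using mq[OF \<phi>] by blast
    from C(2) have "\<forall>\<^sub>F \<epsilon> in at_right 0. \<forall>x\<in>K. C * \<epsilon> ^ m \<le> cmod (R (scale \<epsilon> \<phi>, x))"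
      by (rule eventually_mono) (blast intro: inf_exceedsD)
    with C(1) show ?thesis by blast
  qed
  then show "\<exists>m q. \<forall>\<phi>\<in>mollifiers q. \<exists>C>0. \<forall>\<^sub>F \<epsilon> in at_right 0.
        \<forall>x\<in>K. C * \<epsilon> ^ m \<le> cmod (R (scale \<epsilon> \<phi>, x))" by blast
qed

text \<open>
  For \<open>k = max (m + 1) q\<close> and \<open>\<epsilon> < min 1 C\<close> one has \<open>\<epsilon>\<^sup>k \<le> \<epsilon> \<epsilon>\<^sup>m < C \<epsilon>\<^sup>m\<close>, and mollifiers of order \<open>k\<close> are
  mollifiers of order \<open>q\<close>.
\<close>

lemma inf_exceeds_if_bounded_below:
  assumes "bounded_below \<Omega> R" "compact K \<and> K \<subseteq> \<Omega>"
  shows "\<exists>q\<ge>1. \<forall>\<phi>\<in>mollifiers q. \<forall>\<^sub>F \<epsilon> in at_right 0. inf_exceeds R K \<phi> 1 q \<epsilon>"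
proof -
  obtain m q where mq: "\<And>\<phi>. \<phi> \<in> mollifiers q \<Longrightarrow> \<exists>C>0. \<forall>\<^sub>F \<epsilon> in at_right 0.
        \<forall>x\<in>K. C * \<epsilon> ^ m \<le> cmod (R (scale \<epsilon> \<phi>, x))"
    using bounded_belowE[OF assms(1) conjunct1[OF assms(2)] conjunct2[OF assms(2)]] by blast
  define k where "k = max (Suc m) q"
  have "\<forall>\<^sub>F \<epsilon> in at_right 0. inf_exceeds R K \<phi> 1 k \<epsilon>" if "\<phi> \<in> mollifiers k" for \<phi>
  proof -
    have "\<phi> \<in> mollifiers q" using that mollifiers_maxD unfolding k_def by blast
    from mq[OF this] obtain C where C: "C > 0" "\<forall>\<^sub>F \<epsilon> in at_right 0. \<forall>x\<in>K. C * \<epsilon> ^ m \<le> cmod (R (scale \<epsilon> \<phi>, x))"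
      by blast
    from C(2) eventually_small[OF zero_less_one] eventually_small[OF C(1)] show ?thesis
    proof eventually_elim
      case (elim \<epsilon>)
      have "\<epsilon> ^ k \<le> \<epsilon> ^ Suc m"
        using elim by (intro power_decreasing) (auto simp: k_def)
      also have "\<dots> < C * \<epsilon> ^ m" using elim by simp
      finally show ?case using elim C(1) by (intro inf_exceedsI[where B = "C * \<epsilon> ^ m"]) auto
    qed
  qed
  moreover have "k \<ge> 1" by (simp add: k_def)
  ultimately show ?thesis by blast
qed

lemma moderate_growth_inverse:
  assumes "open \<Omega>" "bounded_below \<Omega> R"
  shows "moderate_growth \<Omega> (\<lambda>p\<in>U_dom \<Omega>. inverse (R p))"
proof (rule moderate_growthI)
  fix K assume K: "compact K" "K \<subseteq> \<Omega>"
  obtain m q where mq: "\<And>\<phi>. \<phi> \<in> mollifiers q \<Longrightarrow> \<exists>C>0. \<forall>\<^sub>F \<epsilon> in at_right 0.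
        \<forall>x\<in>K. C * \<epsilon> ^ m \<le> cmod (R (scale \<epsilon> \<phi>, x))"
    using bounded_belowE[OF assms(2) K] by blast
  have "growth K \<phi> (- int m) (\<lambda>p\<in>U_dom \<Omega>. inverse (R p))" if "\<phi> \<in> mollifiers q" for \<phi>
  proof (rule growth_restrict[OF assms(1) K])
    show "\<phi> \<in> mollifiers 0" using that mollifiers_mono[of 0 q] by auto
    from mq[OF that] obtain C where C: "C > 0" "\<forall>\<^sub>F \<epsilon> in at_right 0. \<forall>x\<in>K. C * \<epsilon> ^ m \<le> cmod (R (scale \<epsilon> \<phi>, x))"
      by blast
    have "\<forall>\<^sub>F \<epsilon> in at_right 0. \<forall>x\<in>K. cmod (inverse (R (scale \<epsilon> \<phi>, x))) \<le> inverse C * \<epsilon> powi (- int m)"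
      using C(2) eventually_small[OF zero_less_one]
    proof eventually_elim
      case (elim \<epsilon>)
      have "inverse (cmod (R (scale \<epsilon> \<phi>, x))) \<le> inverse (C * \<epsilon> ^ m)" if "x \<in> K" for x
        using bspec[OF elim(1) that] elim(2) C(1) by (intro le_imp_inverse_le) simp_all
      then show ?case by (simp add: norm_inverse power_int_minus mult.commute)
    qed
    then show "growth K \<phi> (- int m) (\<lambda>p. inverse (R p))" unfolding growth_def by blast
  qed
  then show "\<exists>N q. \<forall>\<phi>\<in>mollifiers q. growth K \<phi> (- int N) (\<lambda>p\<in>U_dom \<Omega>. inverse (R p))" by blast
qed

lemma moderate_inverse:
  assumes "open \<Omega>" "R \<in> moderate \<Omega>" "bounded_below \<Omega> R" "\<And>p. p \<in> U_dom \<Omega> \<Longrightarrow> R p \<noteq> 0"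
  shows "(\<lambda>p\<in>U_dom \<Omega>. inverse (R p)) \<in> moderate \<Omega>"
  unfolding moderate_iff[OF assms(1)]
proof (intro conjI allI)
  have R: "R \<in> basic_space \<Omega>" using assms(2) by (rule moderate_basic)
  show "(\<lambda>p\<in>U_dom \<Omega>. inverse (R p)) \<in> basic_space \<Omega>"
    using assms(1) R assms(4) by (rule basic_space_inverse)
  fix k
  show "jets \<Omega> (moderate_growth \<Omega>) k (\<lambda>p\<in>U_dom \<Omega>. inverse (R p))"
  proof (rule jets_inverse[OF assms(1)])
    show "jets \<Omega> (moderate_growth \<Omega>) k R" using assms(2) moderate_iff[OF assms(1)] by blast
  qed (use assms R in \<open>blast intro: moderate_growth_add moderate_growth_mult moderate_growth_const moderate_growth_inverse\<close>)+
qed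

text \<open>
  For small \<open>\<epsilon>\<close> the error \<open>R S - 1\<close> is at most \<open>1/2\<close>, so \<open>1/2 \<le> \<bar>R\<bar> \<bar>S\<bar> \<le> \<bar>R\<bar> C \<epsilon>\<^bsup>-N\<^esup>\<close>.
\<close>

lemma bounded_below_if_invertible:
  assumes "open \<Omega>" "S \<in> moderate \<Omega>" "(\<lambda>p\<in>U_dom \<Omega>. R p * S p - 1) \<in> negligible_reps \<Omega>"
  shows "bounded_below \<Omega> R"
  unfolding bounded_below_def
proof (intro allI impI)
  fix K assume "compact K \<and> K \<subseteq> \<Omega>"
  then have K: "compact K" "K \<subseteq> \<Omega>" by auto
  obtain N where N: "\<forall>\<phi>\<in>mollifiers N. growth K \<phi> (- int N) S"
    using moderate_growthE[OF moderate_imp_moderate_growth[OF assms(1,2)] K] .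
  obtain q where q: "\<forall>\<phi>\<in>mollifiers q. growth K \<phi> (int 1) (\<lambda>p\<in>U_dom \<Omega>. R p * S p - 1)"
    using negligible_growthE[OF negligible_reps_imp_negligible_growth[OF assms(1,3)] K order_refl] .
  have "\<exists>C>0. \<forall>\<^sub>F \<epsilon> in at_right 0. \<forall>x\<in>K. C * \<epsilon> ^ N \<le> cmod (R (scale \<epsilon> \<phi>, x))"
    if "\<phi> \<in> mollifiers (max N q)" for \<phi>
  proof -
    have \<phi>: "\<phi> \<in> mollifiers N" "\<phi> \<in> mollifiers q" "\<phi> \<in> mollifiers 0"
      using mollifiers_maxD[OF that] by auto
    obtain C where C: "C > 0" "\<forall>\<^sub>F \<epsilon> in at_right 0. \<forall>x\<in>K. cmod (S (scale \<epsilon> \<phi>, x)) \<le> C * \<epsilon> powi (- int N)"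
      using growthE[OF N[rule_format, OF \<phi>(1)]] by blast
    obtain D where D: "D > 0" "\<forall>\<^sub>F \<epsilon> in at_right 0. \<forall>x\<in>K.
        cmod ((\<lambda>p\<in>U_dom \<Omega>. R p * S p - 1) (scale \<epsilon> \<phi>, x)) \<le> D * \<epsilon> powi int 1"
      using growthE[OF q[rule_format, OF \<phi>(2)]] by blast
    \<comment> \<open>Below this threshold for \<open>\<epsilon>\<close> the error \<open>D \<epsilon>\<close> is at most \<open>1/2\<close>.\<close>
    have "0 < inverse (2 * D)" using D(1) by simp
    have "\<forall>\<^sub>F \<epsilon> in at_right 0. \<forall>x\<in>K. inverse (2 * C) * \<epsilon> ^ N \<le> cmod (R (scale \<epsilon> \<phi>, x))"
      using C(2) D(2) eventually_scale_in_U_dom[OF assms(1) K \<phi>(3)]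
        eventually_small[OF \<open>0 < inverse (2 * D)\<close>]
    proof eventually_elim
      case (elim \<epsilon>)
      show ?case
      proof
        fix x assume x: "x \<in> K"
        let ?R = "R (scale \<epsilon> \<phi>, x)" and ?S = "S (scale \<epsilon> \<phi>, x)"
        have "cmod (1 - ?R * ?S) \<le> D * \<epsilon>"
          using bspec[OF elim(2) x] bspec[OF elim(3) x] norm_minus_commute[of 1 "?R * ?S"] by simp
        also have "\<dots> \<le> D * inverse (2 * D)" using elim(4) D(1) by (intro mult_left_mono) simp_all
        also have "\<dots> = 1 / 2" using D(1) by simp
        finally have "1 / 2 \<le> cmod (?R * ?S)"
          using norm_triangle_sub[of 1 "?R * ?S"] by simp
        also have "\<dots> \<le> cmod ?R * (C * \<epsilon> powi (- int N))"
          unfolding norm_mult using bspec[OF elim(1) x] by (rule mult_left_mono) simp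
        also have "\<dots> = cmod ?R * C / \<epsilon> ^ N" by (simp add: power_int_minus divide_inverse)
        finally have "\<epsilon> ^ N \<le> cmod ?R * (2 * C)"
          using elim(4) by (simp add: pos_le_divide_eq)
        then have "\<epsilon> ^ N / (2 * C) \<le> cmod ?R" using C(1) by (simp only: pos_divide_le_eq mult_pos_pos zero_less_numeral)
        then show "inverse (2 * C) * \<epsilon> ^ N \<le> cmod ?R"
          by (simp only: divide_inverse mult.commute)
      qed
    qed
    then show ?thesis using C(1) by (intro exI[of _ "inverse (2 * C)"]) auto
  qed
  then show "\<exists>m q. \<forall>\<phi>\<in>mollifiers q. \<exists>C>0. \<forall>\<^sub>F \<epsilon> in at_right 0.
      \<forall>x\<in>K. C * \<epsilon> ^ m \<le> cmod (R (scale \<epsilon> \<phi>, x))" by blast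
qed

text \<open>
  With \<open>D = R cnj R + \<delta>\<close> and \<open>S = cnj R / D\<close> the error \<open>R S - 1\<close> equals \<open>- \<delta> / D\<close>. The denominator satisfies
  \<open>D \<ge> \<delta> > 0\<close> everywhere, which makes \<open>S\<close> smooth, and \<open>D \<ge> \<bar>R\<bar>\<^sup>2\<close>, which gives it a lower bound on compact
  sets and makes \<open>1/D\<close> moderate.
\<close>

lemma invertible_if_bounded_below:
  assumes "open \<Omega>" "R \<in> moderate \<Omega>" "bounded_below \<Omega> R"
  shows "\<exists>S\<in>moderate \<Omega>. (\<lambda>p\<in>U_dom \<Omega>. R p * S p - 1) \<in> negligible_reps \<Omega>"
proof -
  let ?\<delta> = "\<lambda>p\<in>U_dom \<Omega>. complex_of_real (damping (fst p))"
  define D where "D = (\<lambda>p\<in>U_dom \<Omega>. (\<lambda>p\<in>U_dom \<Omega>. R p * (\<lambda>p\<in>U_dom \<Omega>. cnj (R p)) p) p + ?\<delta> p)"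
  define S where "S = (\<lambda>p\<in>U_dom \<Omega>. (\<lambda>p\<in>U_dom \<Omega>. cnj (R p)) p * (\<lambda>p\<in>U_dom \<Omega>. inverse (D p)) p)"
  have \<delta>: "?\<delta> \<in> negligible_reps \<Omega>" by (rule damping_negligible[OF assms(1)])
  have D: "D \<in> moderate \<Omega>"
    unfolding D_def using assms(1,2) negligible_imp_moderate[OF assms(1) \<delta>]
    by (intro moderate_add moderate_mult moderate_cnj)
  have D_eq: "D p = of_real ((cmod (R p))\<^sup>2 + damping (fst p))" if "p \<in> U_dom \<Omega>" for p
    using that by (simp add: D_def complex_norm_square[symmetric])
  have pos: "0 < (cmod (R p))\<^sup>2 + damping (fst p)" for p
    by (simp add: damping_def add_nonneg_pos)
  have D_nz: "D p \<noteq> 0" if "p \<in> U_dom \<Omega>" for p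
    using D_eq[OF that] pos[of p] by (simp del: of_real_add)
  have D_ge: "(cmod (R p))\<^sup>2 \<le> cmod (D p)" if "p \<in> U_dom \<Omega>" for p
    unfolding D_eq[OF that] norm_of_real by (simp add: damping_def)
  have below: "bounded_below \<Omega> D"
    unfolding bounded_below_def
  proof (intro allI impI)
    fix K assume "compact K \<and> K \<subseteq> \<Omega>"
    then have K: "compact K" "K \<subseteq> \<Omega>" by auto
    obtain m q where mq: "\<And>\<phi>. \<phi> \<in> mollifiers q \<Longrightarrow> \<exists>C>0. \<forall>\<^sub>F \<epsilon> in at_right 0.
        \<forall>x\<in>K. C * \<epsilon> ^ m \<le> cmod (R (scale \<epsilon> \<phi>, x))"
    using bounded_belowE[OF assms(3) K] by blast
    have "\<exists>C>0. \<forall>\<^sub>F \<epsilon> in at_right 0. \<forall>x\<in>K. C * \<epsilon> ^ (m * 2) \<le> cmod (D (scale \<epsilon> \<phi>, x))"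
      if "\<phi> \<in> mollifiers q" for \<phi>
    proof -
      from mq[OF that] obtain C where C: "C > 0" "\<forall>\<^sub>F \<epsilon> in at_right 0. \<forall>x\<in>K. C * \<epsilon> ^ m \<le> cmod (R (scale \<epsilon> \<phi>, x))"
      by blast
      have "\<phi> \<in> mollifiers 0" using that mollifiers_mono[of 0 q] by auto
      from C(2) eventually_scale_in_U_dom[OF assms(1) K this] eventually_small[OF zero_less_one]
      have "\<forall>\<^sub>F \<epsilon> in at_right 0. \<forall>x\<in>K. C\<^sup>2 * \<epsilon> ^ (m * 2) \<le> cmod (D (scale \<epsilon> \<phi>, x))"
      proof eventually_elim
        case (elim \<epsilon>)
        show ?case
        proof
          fix x assume x: "x \<in> K"
          have "C\<^sup>2 * \<epsilon> ^ (m * 2) = (C * \<epsilon> ^ m)\<^sup>2"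
            by (simp add: power_mult_distrib power_mult)
          also have "\<dots> \<le> (cmod (R (scale \<epsilon> \<phi>, x)))\<^sup>2"
            using elim x C(1) by (intro power_mono) auto
          also have "\<dots> \<le> cmod (D (scale \<epsilon> \<phi>, x))" using elim x by (intro D_ge) auto
          finally show "C\<^sup>2 * \<epsilon> ^ (m * 2) \<le> cmod (D (scale \<epsilon> \<phi>, x))" .
        qed
      qed
      then show ?thesis using C(1) by (intro exI[of _ "C\<^sup>2"]) auto
    qed
    then show "\<exists>m q. \<forall>\<phi>\<in>mollifiers q. \<exists>C>0. \<forall>\<^sub>F \<epsilon> in at_right 0.
        \<forall>x\<in>K. C * \<epsilon> ^ m \<le> cmod (D (scale \<epsilon> \<phi>, x))" by blast
  qed
  have inv: "(\<lambda>p\<in>U_dom \<Omega>. inverse (D p)) \<in> moderate \<Omega>"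
    using assms(1) D below D_nz by (rule moderate_inverse)
  then have "S \<in> moderate \<Omega>"
    unfolding S_def using assms(1,2) by (intro moderate_mult moderate_cnj)
  moreover have "(\<lambda>p\<in>U_dom \<Omega>. R p * S p - 1) \<in> negligible_reps \<Omega>"
  proof -
    let ?E = "\<lambda>p\<in>U_dom \<Omega>. ?\<delta> p * (\<lambda>p\<in>U_dom \<Omega>. (\<lambda>p\<in>U_dom \<Omega>. - 1) p * (\<lambda>p\<in>U_dom \<Omega>. inverse (D p)) p) p"
    have "R p * S p - 1 = ?E p" if p: "p \<in> U_dom \<Omega>" for p
    proof -
      have "D p = R p * cnj (R p) + ?\<delta> p" using p by (simp add: D_def)
      then have "(R p * cnj (R p) - D p) * inverse (D p) = - ?\<delta> p * inverse (D p)" by simp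
      then have "R p * cnj (R p) * inverse (D p) - 1 = - ?\<delta> p * inverse (D p)"
        using D_nz[OF p] by (simp add: left_diff_distrib)
      then show ?thesis
        using p by (simp add: S_def mult.assoc)
    qed
    then have "(\<lambda>p\<in>U_dom \<Omega>. R p * S p - 1) = ?E" by (auto simp: fun_eq_iff)
    also have "\<dots> \<in> negligible_reps \<Omega>"
      by (intro negligible_reps_mult moderate_mult moderate_const inv \<delta> assms(1))
    finally show ?thesis .
  qed
  ultimately show ?thesis by blast
qed

theorem theorem21:
  fixes \<Omega> :: "(real^'n::finite) set" and Rt :: "'n rep set"
  assumes "open \<Omega>"
    and "Rt \<in> carrier (gen_fun_ring \<Omega>)"
  shows "(Rt \<in> Units (gen_fun_ring \<Omega>) \<longleftrightarrow>
      (\<forall>R\<in>Rt. \<forall>K. compact K \<and> K \<subseteq> \<Omega> \<longrightarrow>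
        (\<exists>m\<ge>1. \<exists>q\<ge>1. \<forall>\<phi>\<in>mollifiers q. \<exists>C>0. \<exists>\<epsilon>\<^sub>0>0. \<forall>\<epsilon>.
           0 < \<epsilon> \<and> \<epsilon> < \<epsilon>\<^sub>0 \<longrightarrow> inf_exceeds R K \<phi> C m \<epsilon>)))
    \<and> (\<forall>R\<in>Rt.
      ((\<forall>K. compact K \<and> K \<subseteq> \<Omega> \<longrightarrow>
        (\<exists>m\<ge>1. \<exists>q\<ge>1. \<forall>\<phi>\<in>mollifiers q. \<exists>C>0. \<exists>\<epsilon>\<^sub>0>0. \<forall>\<epsilon>.
           0 < \<epsilon> \<and> \<epsilon> < \<epsilon>\<^sub>0 \<longrightarrow> inf_exceeds R K \<phi> C m \<epsilon>)) \<longleftrightarrow>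
      (\<forall>K. compact K \<and> K \<subseteq> \<Omega> \<longrightarrow>
        (\<exists>m\<ge>1. \<exists>q\<ge>1. \<forall>\<phi>\<in>mollifiers q. \<exists>\<epsilon>\<^sub>0>0. \<forall>\<epsilon>.
           0 < \<epsilon> \<and> \<epsilon> < \<epsilon>\<^sub>0 \<longrightarrow> inf_exceeds R K \<phi> 1 m \<epsilon>)))
    \<and> ((\<forall>K. compact K \<and> K \<subseteq> \<Omega> \<longrightarrow>
        (\<exists>m\<ge>1. \<exists>q\<ge>1. \<forall>\<phi>\<in>mollifiers q. \<exists>C>0. \<exists>\<epsilon>\<^sub>0>0. \<forall>\<epsilon>.
           0 < \<epsilon> \<and> \<epsilon> < \<epsilon>\<^sub>0 \<longrightarrow> inf_exceeds R K \<phi> C m \<epsilon>)) \<longleftrightarrow>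
      (\<forall>K. compact K \<and> K \<subseteq> \<Omega> \<longrightarrow>
        (\<exists>q\<ge>1. \<forall>\<phi>\<in>mollifiers q. \<exists>C>0. \<exists>\<epsilon>\<^sub>0>0. \<forall>\<epsilon>.
           0 < \<epsilon> \<and> \<epsilon> < \<epsilon>\<^sub>0 \<longrightarrow> inf_exceeds R K \<phi> C q \<epsilon>)))
    \<and> ((\<forall>K. compact K \<and> K \<subseteq> \<Omega> \<longrightarrow>
        (\<exists>m\<ge>1. \<exists>q\<ge>1. \<forall>\<phi>\<in>mollifiers q. \<exists>C>0. \<exists>\<epsilon>\<^sub>0>0. \<forall>\<epsilon>.
           0 < \<epsilon> \<and> \<epsilon> < \<epsilon>\<^sub>0 \<longrightarrow> inf_exceeds R K \<phi> C m \<epsilon>)) \<longleftrightarrow>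
      (\<forall>K. compact K \<and> K \<subseteq> \<Omega> \<longrightarrow>
        (\<exists>q\<ge>1. \<forall>\<phi>\<in>mollifiers q. \<exists>\<epsilon>\<^sub>0>0. \<forall>\<epsilon>.
           0 < \<epsilon> \<and> \<epsilon> < \<epsilon>\<^sub>0 \<longrightarrow> inf_exceeds R K \<phi> 1 q \<epsilon>))))"
  (is "(_ \<longleftrightarrow> (\<forall>R\<in>Rt. ?A R)) \<and> (\<forall>R\<in>Rt. (_ \<longleftrightarrow> ?B R) \<and> (_ \<longleftrightarrow> ?C R) \<and> (_ \<longleftrightarrow> ?D R))")
proof -
  have iff: "?A R \<longleftrightarrow> bounded_below \<Omega> R" "?B R \<longleftrightarrow> bounded_below \<Omega> R"
    "?C R \<longleftrightarrow> bounded_below \<Omega> R" "?D R \<longleftrightarrow> bounded_below \<Omega> R" for R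
    unfolding eventually_at_right_0_iff[symmetric]
    by (meson zero_less_one[where 'a = real] bounded_below_if_inf_exceeds[of \<Omega> R]
        inf_exceeds_if_bounded_below[of \<Omega> R])+
  have units: "Rt \<in> Units (gen_fun_ring \<Omega>) \<longleftrightarrow> bounded_below \<Omega> R" if "R \<in> Rt" for R
    using Units_gen_fun_ring_iff[OF assms that] gen_fun_ring_repD(2)[OF assms that]
      bounded_below_if_invertible[OF assms(1)] invertible_if_bounded_below[OF assms(1)] by blast
  show ?thesis
    unfolding iff using units gen_fun_ring_repD(1)[OF assms] by blast
qed

end
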